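(* Let $X$ be a real, separable, infinite-dimensional Banach space and let $\alpha$ be a countable ordinal with $Sz(X)\leq \omega^\alpha$. Then $X$ satisfies subsequential $X_\alpha$-upper tree estimates, where $X_\alpha$ is the Schreier space of order $\alpha$ with its canonical basis $(e_n)$.
   Context: Szlenk index: for a separable Banach space $X$, a weak$^*$ compact $K\subset X^*$ and $\varepsilon>0$, let $(K)'_\varepsilon=\{z\in K:\text{ for all } w^*\text{-neighborhoods } U \text{ of } z,\ \mathrm{diam}(U\cap K)>\varepsilon\}$. Put $P_0(K,\varepsilon)=K$, $P_{\alpha+1}(K,\varepsilon)=(P_\alpha(K,\varepsilon))'_\varepsilon$ for $\alpha<\omega_1$, and $P_\alpha(K,\varepsilon)=\bigcap_{\beta<\alpha}P_\beta(K,\varepsilon)$ for limit $\alpha<\omega_1$. Let $\eta(K,\varepsilon)=\min\{\alpha<\omega_1: P_\alpha(K,\varepsilon)=\varnothing\}$ if such $\alpha$ exists and $\eta(K,\varepsilon)=\omega_1$ otherwise. Then $Sz(X)=\sup_{\varepsilon>0}\eta(B_{X^*},\varepsilon)$. Schreier families and spaces: for $E,F$ finite subsets of $\mathbb{N}=\{1,2,\dots\}$, $E<F$ means $\max E<\min F$ and $n\leq E$ means $n\leq\min E$, with $\min\varnothing=\infty$, $\max\varnothing=0$. Put $S_0=\{\{n\}:n\in\mathbb{N}\}\cup\{\varnothing\}$; $S_{\alpha+1}=\{\bigcup_{n=1}^m E_n: m\leq E_1<\ldots<E_m,\ E_n\in S_\alpha\text{ for all }n\}$; for a limit ordinal $\alpha<\omega_1$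 fix a sequence $\alpha_n\uparrow\alpha$ and put $S_\alpha=\{F:\exists n\leq F\text{ with } F\in S_{\alpha_n}\}$ (an arbitrary such sequence is fixed for each limit ordinal). On the space $c_{00}$ of finitely supported real sequences let $\|x\|_\alpha=\max_{E\in S_\alpha}\|Ex\|_1$, where $Ex=(\chi_E(n)x_n)_n$. The Schreier space $X_\alpha$ of order $\alpha$ is the completion of $(c_{00},\|\cdot\|_\alpha)$; the canonical basis $(e_n)$ of $c_{00}$ is a normalized, $1$-unconditional basis of $X_\alpha$. Domination: for $C>0$, a sequence $(x_n)$ is $C$-dominated by $(f_n)$ if $\|\sum a_nx_n\|\leq C\|\sum a_nf_n\|$ for all $(a_n)\in c_{00}$. Tree estimates: let $T_\ell=\{(n_1,\ldots,n_\ell):n_1<\ldots<n_\ell,\ n_i\in\mathbb{N}\}$, $T_\infty=\bigcup_{\ell\ge1}T_\ell$, $T^{\text{even}}_\infty=\bigcup_{\ell\geq 1}T_{2\ell}$. An even tree in $X$ is a family $(x_t)_{t\in T^{\text{even}}_\infty}$ in $X$; it is normalized if $\|x_t\|=1$ for all $t$. Its nodes are the sequences $(x_{(t,k)})_{k>k_{2n-1}}$ with $n\in\mathbb{N}$, $t=(k_1,\ldots,k_{2n-1})\in T_\infty$; its branches are the sequences $(k_{2n-1},x_{(k_1,\ldots,k_{2n})})_{n=1}^\infty$ with $k_1<k_2<\ldots$. It is weakly null if every node is a weakly null sequence. For a Banach space $V$ with normalized $1$-unconditional basis $(v_n)$ and $C\geq1$, an infinite-dimensional Banach space $X$ satisfies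 subsequential $C$-$V$-upper tree estimates if every normalized weakly null even tree in $X$ has a branch $(k_{2n-1},x_{(k_1,\ldots,k_{2n})})_n$ such that $(x_{(k_1,\ldots,k_{2n})})_n$ is $C$-dominated by $(v_{k_{2n-1}})_n$. $X$ satisfies subsequential $V$-upper tree estimates if this holds for some $C\geq1$. *)

theory Defs
  imports "HOL-Analysis.Analysis" "HOL-Library.Nat_Bijection"
    "HOL-Probability.Discrete_Topology"
begin

unbundle cardinal_syntax

section \<open>Ordinals\<close>

text \<open>
  The type of all ordinals below \<open>\<omega>\<^sub>2\<close>. It contains \<open>\<omega>\<^sub>1\<close> as an element, is closed under
  ordinal arithmetic, and every family of at most \<open>\<omega>\<^sub>1\<close> many elements has a supremum in it.
\<close>

typedef ordinal = "Field (cardSuc (cardSuc natLeq))"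
proof -
  have "Field (cardSuc (cardSuc natLeq)) \<noteq> {}"
    by (rule Field_cardSuc_not_empty) (rule cardSuc_Card_order[OF natLeq_Card_order])
  then show ?thesis by blast
qed

lemma Card_order_omega2: "Card_order (cardSuc (cardSuc natLeq))"
  by (intro cardSuc_Card_order natLeq_Card_order)

lemma Well_order_omega2: "Well_order (cardSuc (cardSuc natLeq))"
  using Card_order_omega2 by (rule card_order_on_well_order_on)

instantiation ordinal :: wellorder
begin

definition "\<alpha> \<le> \<beta> \<longleftrightarrow> (Rep_ordinal \<alpha>, Rep_ordinal \<beta>) \<in> cardSuc (cardSuc natLeq)"

definition "\<alpha> < \<beta> \<longleftrightarrow> \<alpha> \<le> \<beta> \<and> \<not> \<beta> \<le> (\<alpha>::ordinal)"

instance
proof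
  let ?r = "cardSuc (cardSuc natLeq)"
  have R: "refl_on (Field ?r) ?r" and T: "trans ?r" and A: "antisym ?r"
    and Tot: "total_on (Field ?r) ?r" and W: "wf (?r - Id)"
    using Well_order_omega2
    by (auto simp: well_order_on_def linear_order_on_def partial_order_on_def preorder_on_def)
  fix x y z :: ordinal
  show "x < y \<longleftrightarrow> x \<le> y \<and> \<not> y \<le> x" by (simp add: less_ordinal_def)
  show refl: "x \<le> x" for x :: ordinal
    using R Rep_ordinal[of x] by (auto simp: less_eq_ordinal_def refl_on_def)
  show "x \<le> y \<Longrightarrow> y \<le> z \<Longrightarrow> x \<le> z"
    using T by (auto simp: less_eq_ordinal_def dest: transD)
  show antisym: "x \<le> y \<Longrightarrow> y \<le> x \<Longrightarrow> x = y" for x y :: ordinal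
    unfolding less_eq_ordinal_def by (metis A antisymD Rep_ordinal_inject)
  show "x \<le> y \<or> y \<le> x"
    using Tot refl Rep_ordinal[of x] Rep_ordinal[of y]
    by (cases "x = y") (auto simp: less_eq_ordinal_def total_on_def Rep_ordinal_inject)
  fix P :: "ordinal \<Rightarrow> bool" and a :: ordinal
  assume step: "\<And>x. (\<And>y. y < x \<Longrightarrow> P y) \<Longrightarrow> P x"
  have "wf (inv_image (?r - Id) Rep_ordinal)"
    using W by (rule wf_inv_image)
  then show "P a"
  proof (induction a rule: wf_induct_rule)
    case (less x)
    show ?case
    proof (rule step)
      fix y assume "y < x"
      then have "y \<le> x" "y \<noteq> x"
        using refl by (auto simp: less_ordinal_def)
      then show "P y"
        by (intro less.IH) (auto simp: less_eq_ordinal_def Rep_ordinal_inject)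
    qed
  qed
qed

end

lemma infinite_Field_omega2: "infinite (Field (cardSuc (cardSuc natLeq)))"
  using cardSuc_finite[OF cardSuc_Card_order[OF natLeq_Card_order]]
    cardSuc_finite[OF natLeq_Card_order]
  by (simp add: Field_natLeq)

lemma ordinal_no_max: "\<exists>\<beta>. (\<alpha>::ordinal) < \<beta>"
proof -
  obtain b where b: "b \<in> Field (cardSuc (cardSuc natLeq))" "Rep_ordinal \<alpha> \<noteq> b"
    "(Rep_ordinal \<alpha>, b) \<in> cardSuc (cardSuc natLeq)"
    using infinite_Card_order_limit[OF Card_order_omega2 infinite_Field_omega2 Rep_ordinal[of \<alpha>]]
    by blast
  then have "\<alpha> \<le> Abs_ordinal b" "\<alpha> \<noteq> Abs_ordinal b"
    by (auto simp: less_eq_ordinal_def Abs_ordinal_inverse)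
  then show ?thesis by (auto simp: order_less_le)
qed

lemma card_ordinal: "|UNIV :: ordinal set| =o cardSuc (cardSuc natLeq)"
proof -
  have "bij_betw Rep_ordinal UNIV (Field (cardSuc (cardSuc natLeq)))"
    by (metis bij_betw_def inj_on_def Rep_ordinal_inject type_definition.Rep_range
        type_definition_ordinal)
  then have "|UNIV :: ordinal set| =o |Field (cardSuc (cardSuc natLeq))|"
    using card_of_ordIso by blast
  then show ?thesis
    using card_of_Field_ordIso[OF Card_order_omega2] ordIso_transitive by blast
qed

lemma card_atMost_ordinal: "|{..\<alpha>::ordinal}| \<le>o cardSuc natLeq"
proof -
  obtain \<beta> where \<beta>: "\<alpha> < \<beta>" using ordinal_no_max by blast
  let ?U = "underS (cardSuc (cardSuc natLeq)) (Rep_ordinal \<beta>)"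
  have "Rep_ordinal ` {..\<alpha>} \<subseteq> ?U"
  proof
    fix x assume "x \<in> Rep_ordinal ` {..\<alpha>}"
    then obtain \<gamma> where "x = Rep_ordinal \<gamma>" "\<gamma> < \<beta>"
      using \<beta> by auto
    then show "x \<in> ?U"
      by (auto simp: underS_def less_le less_eq_ordinal_def Rep_ordinal_inject)
  qed
  then have "|{..\<alpha>}| \<le>o |?U|"
    by (intro card_of_ordLeqI[where f = Rep_ordinal])
       (auto simp: inj_on_def Rep_ordinal_inject)
  moreover have "|?U| <o cardSuc (cardSuc natLeq)"
    using card_of_underS[OF Card_order_omega2 Rep_ordinal] .
  ultimately have "|{..\<alpha>}| <o cardSuc (cardSuc natLeq)"
    by (rule ordLeq_ordLess_trans)
  then show ?thesis
    using cardSuc_ordLeq_ordLess[OF cardSuc_Card_order[OF natLeq_Card_order] card_of_Card_order]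
    by blast
qed

lemma bdd_above_ordinal:
  fixes A :: "ordinal set"
  assumes "|A| \<le>o cardSuc natLeq"
  shows "bdd_above A"
proof (rule ccontr)
  assume "\<not> bdd_above A"
  then have "UNIV = (\<Union>\<alpha>\<in>A. {..\<alpha>})"
    by (auto simp: bdd_above_def) (meson linear)
  moreover have "|\<Union>\<alpha>\<in>A. {..\<alpha>}| \<le>o cardSuc natLeq"
  proof (rule card_of_UNION_ordLeq_infinite_Field)
    show "infinite (Field (cardSuc natLeq))"
      using cardSuc_finite[OF natLeq_Card_order] by (simp add: Field_natLeq)
  qed (use assms card_atMost_ordinal in \<open>auto intro: cardSuc_Card_order natLeq_Card_order\<close>)
  ultimately have "|UNIV :: ordinal set| \<le>o cardSuc natLeq" by simp
  then have "cardSuc (cardSuc natLeq) \<le>o cardSuc natLeq"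
    using card_ordinal ordIso_ordLeq_trans ordIso_symmetric by blast
  then show False
    using cardSuc_greater[OF cardSuc_Card_order[OF natLeq_Card_order]] not_ordLess_ordLeq by blast
qed

lemma countable_iff_natLeq: "countable A \<longleftrightarrow> |A| \<le>o natLeq"
proof -
  have "countable A \<longleftrightarrow> |A| \<le>o |UNIV :: nat set|"
    unfolding countable_def card_of_ordLeq[symmetric] by simp
  then show ?thesis
    using card_of_nat ordIso_symmetric ordLeq_ordIso_trans by blast
qed

lemma bdd_above_ordinal_countable:
  fixes A :: "ordinal set"
  assumes "countable A"
  shows "bdd_above A"
proof (rule bdd_above_ordinal)
  have "|A| \<le>o natLeq"
    using assms countable_iff_natLeq by blast
  then show "|A| \<le>o cardSuc natLeq"
    using cardSuc_ordLeq[OF natLeq_Card_order] ordLeq_transitive by blast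
qed

instantiation ordinal :: conditionally_complete_linorder
begin

definition "inf \<alpha> \<beta> = min \<alpha> (\<beta>::ordinal)"
definition "sup \<alpha> \<beta> = max \<alpha> (\<beta>::ordinal)"
definition "Inf A = (LEAST \<alpha>::ordinal. \<alpha> \<in> A)"
definition "Sup A = (LEAST \<gamma>::ordinal. \<forall>\<alpha>\<in>A. \<alpha> \<le> \<gamma>)"

instance
proof
  fix x y z :: ordinal and X :: "ordinal set"
  show "inf x y \<le> x" "inf x y \<le> y" "x \<le> y \<Longrightarrow> x \<le> z \<Longrightarrow> x \<le> inf y z"
    "x \<le> sup x y" "y \<le> sup x y" "y \<le> x \<Longrightarrow> z \<le> x \<Longrightarrow> sup y z \<le> x"
    by (simp_all add: inf_ordinal_def sup_ordinal_def)
  show "x \<in> X \<Longrightarrow> bdd_below X \<Longrightarrow> Inf X \<le> x"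
    by (simp add: Inf_ordinal_def Least_le)
  show "X \<noteq> {} \<Longrightarrow> (\<And>x. x \<in> X \<Longrightarrow> z \<le> x) \<Longrightarrow> z \<le> Inf X"
    unfolding Inf_ordinal_def by (meson LeastI_ex all_not_in_conv)
  show "x \<in> X \<Longrightarrow> bdd_above X \<Longrightarrow> x \<le> Sup X"
  proof -
    assume "x \<in> X" "bdd_above X"
    then obtain M where "\<forall>\<alpha>\<in>X. \<alpha> \<le> M" by (auto simp: bdd_above_def)
    then have "\<forall>\<alpha>\<in>X. \<alpha> \<le> Sup X"
      unfolding Sup_ordinal_def by (rule LeastI[where P = "\<lambda>\<gamma>. \<forall>\<alpha>\<in>X. \<alpha> \<le> \<gamma>"])
    with \<open>x \<in> X\<close> show ?thesis by blast
  qed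
  show "X \<noteq> {} \<Longrightarrow> (\<And>x. x \<in> X \<Longrightarrow> x \<le> z) \<Longrightarrow> Sup X \<le> z"
    unfolding Sup_ordinal_def by (rule Least_le) blast
qed

end

definition ord_suc :: "ordinal \<Rightarrow> ordinal"
  where "ord_suc \<alpha> = (LEAST \<beta>. \<alpha> < \<beta>)"

lemma less_ord_suc: "\<alpha> < ord_suc \<alpha>"
  unfolding ord_suc_def using ordinal_no_max by (rule LeastI_ex)

lemma ord_suc_le: "\<alpha> < \<beta> \<Longrightarrow> ord_suc \<alpha> \<le> \<beta>"
  unfolding ord_suc_def by (rule Least_le)

lemma ord_suc_inject [simp]: "ord_suc \<alpha> = ord_suc \<beta> \<longleftrightarrow> \<alpha> = \<beta>"
  by (metis less_ord_suc linorder_neqE ord_suc_le leD)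

instantiation ordinal :: zero_neq_one
begin

definition "0 = (LEAST \<alpha>::ordinal. True)"
definition "1 = ord_suc 0"

instance
  by standard (metis less_irrefl less_ord_suc one_ordinal_def)

end

lemma zero_le_ordinal [simp]: "0 \<le> (\<alpha>::ordinal)"
  unfolding zero_ordinal_def by (simp add: Least_le)

definition is_limit :: "ordinal \<Rightarrow> bool"
  where "is_limit \<alpha> \<longleftrightarrow> \<alpha> \<noteq> 0 \<and> (\<nexists>\<beta>. \<alpha> = ord_suc \<beta>)"

text \<open>
  Transfinite recursion with initial value \<open>z\<close>, successor step \<open>s\<close> and limit step \<open>l\<close>; the limit step
  at \<open>\<alpha>\<close> receives the values at the ordinals below \<open>\<alpha>\<close>. See \<open>ord_rec_0\<close>, \<open>ord_rec_suc\<close> and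
  \<open>ord_rec_limit\<close> for the resulting equations.
\<close>

function ord_rec :: "'a \<Rightarrow> ('a \<Rightarrow> 'a) \<Rightarrow> (ordinal \<Rightarrow> (ordinal \<Rightarrow> 'a) \<Rightarrow> 'a) \<Rightarrow> ordinal \<Rightarrow> 'a" where
  "ord_rec z s l \<alpha> =
    (if \<alpha> = 0 then z
     else if \<exists>\<beta>. \<alpha> = ord_suc \<beta> then s (ord_rec z s l (THE \<beta>. \<alpha> = ord_suc \<beta>))
     else l \<alpha> (\<lambda>\<beta>. if \<beta> < \<alpha> then ord_rec z s l \<beta> else undefined))"
  by auto
termination
  by (relation "inv_image {(\<alpha>, \<beta>). \<alpha> < \<beta>} (\<lambda>(z, s, l, \<alpha>). \<alpha>)")
     (auto simp: wf less_ord_suc intro!: wf_inv_image)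

declare ord_rec.simps [simp del]

lemma ord_rec_0: "ord_rec z s l 0 = z"
  by (simp add: ord_rec.simps)

lemma ord_rec_suc: "ord_rec z s l (ord_suc \<alpha>) = s (ord_rec z s l \<alpha>)"
proof -
  have "ord_suc \<alpha> \<noteq> 0"
    by (metis less_ord_suc leD zero_le_ordinal)
  then show ?thesis
    by (subst ord_rec.simps) auto
qed

lemma ord_rec_limit:
  assumes "is_limit \<alpha>"
  shows "ord_rec z s l \<alpha> = l \<alpha> (\<lambda>\<beta>. if \<beta> < \<alpha> then ord_rec z s l \<beta> else undefined)"
  using assms unfolding is_limit_def by (subst ord_rec.simps) auto

instantiation ordinal :: "{plus, times}"
begin

definition
  "\<alpha> + \<beta> = ord_rec \<alpha> ord_suc (\<lambda>\<delta> f. SUP \<gamma>\<in>{..<\<delta>}. f \<gamma>) \<beta>"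

definition
  "\<alpha> * \<beta> = ord_rec 0 (\<lambda>\<gamma>. \<gamma> + \<alpha>) (\<lambda>\<delta> f. SUP \<gamma>\<in>{..<\<delta>}. f \<gamma>) \<beta>"

instance ..

end

text \<open>Ordinal exponentiation, for bases \<open>\<alpha> \<noteq> 0\<close>.\<close>

definition ord_pow :: "ordinal \<Rightarrow> ordinal \<Rightarrow> ordinal"
  where "ord_pow \<alpha> \<beta> = ord_rec 1 (\<lambda>\<gamma>. \<gamma> * \<alpha>) (\<lambda>\<delta> f. SUP \<gamma>\<in>{..<\<delta>}. f \<gamma>) \<beta>"

definition omega0 :: ordinal
  where "omega0 = (LEAST \<alpha>. infinite {..<\<alpha>})"

definition omega1 :: ordinal
  where "omega1 = (LEAST \<alpha>. uncountable {..<\<alpha>})"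

lemma ex_uncountable_lessThan: "\<exists>\<alpha>::ordinal. uncountable {..<\<alpha>}"
proof (rule ccontr)
  assume *: "\<nexists>\<alpha>::ordinal. uncountable {..<\<alpha>}"
  have "|{..<\<alpha>::ordinal}| \<le>o natLeq" for \<alpha>
    using * countable_iff_natLeq by blast
  moreover obtain A :: "ordinal set" where A: "|A| =o cardSuc natLeq"
  proof -
    have "cardSuc natLeq \<le>o |UNIV :: ordinal set|"
      using cardSuc_ordLeq[OF cardSuc_Card_order[OF natLeq_Card_order]] card_ordinal
        ordIso_symmetric ordLeq_ordIso_trans by blast
    moreover have "|Field (cardSuc natLeq)| =o cardSuc natLeq"
      by (intro card_of_Field_ordIso cardSuc_Card_order natLeq_Card_order)
    ultimately have "|Field (cardSuc natLeq)| \<le>o |UNIV :: ordinal set|"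
      using ordIso_ordLeq_trans by blast
    then obtain f :: "nat set \<Rightarrow> ordinal" where "inj_on f (Field (cardSuc natLeq))"
      by (auto simp: card_of_ordLeq[symmetric])
    then have "|Field (cardSuc natLeq)| =o |f ` Field (cardSuc natLeq)|"
      using card_of_ordIso inj_on_imp_bij_betw by blast
    then have "|f ` Field (cardSuc natLeq)| =o cardSuc natLeq"
      using \<open>|Field (cardSuc natLeq)| =o cardSuc natLeq\<close>
        ordIso_symmetric ordIso_transitive by blast
    then show ?thesis using that by blast
  qed
  moreover obtain M where "\<forall>\<alpha>\<in>A. \<alpha> < M"
  proof -
    obtain m where "\<forall>\<alpha>\<in>A. \<alpha> \<le> m"
      using bdd_above_ordinal[of A] A ordIso_imp_ordLeq unfolding bdd_above_def by blast
    then show ?thesis using that[of "ord_suc m"] less_ord_suc[of m] by (meson order_le_less_trans)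
  qed
  ultimately have "|A| \<le>o natLeq"
    by (meson card_of_mono1 lessThan_iff ordLeq_transitive subsetI)
  then have "cardSuc natLeq \<le>o natLeq"
    using A ordIso_ordLeq_trans ordIso_symmetric by blast
  then show False
    using cardSuc_greater[OF natLeq_Card_order] not_ordLess_ordLeq by blast
qed

lemma less_omega1_iff: "\<alpha> < omega1 \<longleftrightarrow> countable {..<\<alpha>}"
proof
  show "\<alpha> < omega1 \<Longrightarrow> countable {..<\<alpha>}"
    unfolding omega1_def using not_less_Least by blast
  assume "countable {..<\<alpha>}"
  moreover have "uncountable {..<omega1}"
    unfolding omega1_def using ex_uncountable_lessThan by (rule LeastI_ex)
  ultimately show "\<alpha> < omega1"
    by (meson countable_subset lessThan_subset_iff not_le)
qed


unbundle no cardinal_syntax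


section \<open>The Szlenk index\<close>

text \<open>
  The dual of \<open>'a\<close> is \<open>'a \<Rightarrow>\<^sub>L real\<close>; the strong operator topology on it, i.e. the topology
  of pointwise convergence, is the weak-star topology.
\<close>

definition szlenk_derivation ::
    "real \<Rightarrow> ('a::real_normed_vector \<Rightarrow>\<^sub>L real) set \<Rightarrow> ('a \<Rightarrow>\<^sub>L real) set"
  where "szlenk_derivation \<epsilon> K =
    {z \<in> K. \<forall>U. openin strong_operator_topology U \<and> z \<in> U \<longrightarrow> diameter (U \<inter> K) > \<epsilon>}"

definition szlenk_set ::
    "ordinal \<Rightarrow> ('a::real_normed_vector \<Rightarrow>\<^sub>L real) set \<Rightarrow> real \<Rightarrow> ('a \<Rightarrow>\<^sub>L real) set"
  where "szlenk_set \<alpha> K \<epsilon> =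
    ord_rec K (szlenk_derivation \<epsilon>) (\<lambda>\<delta> P. \<Inter>\<beta>\<in>{..<\<delta>}. P \<beta>) \<alpha>"

definition szlenk_eta :: "('a::real_normed_vector \<Rightarrow>\<^sub>L real) set \<Rightarrow> real \<Rightarrow> ordinal"
  where "szlenk_eta K \<epsilon> =
    (if \<exists>\<alpha><omega1. szlenk_set \<alpha> K \<epsilon> = {}
     then LEAST \<alpha>. \<alpha> < omega1 \<and> szlenk_set \<alpha> K \<epsilon> = {}
     else omega1)"

definition szlenk_index :: "'a::real_normed_vector itself \<Rightarrow> ordinal"
  where "szlenk_index _ = (SUP \<epsilon>\<in>{0<..}. szlenk_eta (cball 0 1 :: ('a \<Rightarrow>\<^sub>L real) set) \<epsilon>)"

lemma szlenk_eta_le_omega1: "szlenk_eta K \<epsilon> \<le> omega1"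
proof (cases "\<exists>\<alpha><omega1. szlenk_set \<alpha> K \<epsilon> = {}")
  case True
  then have "(LEAST \<alpha>. \<alpha> < omega1 \<and> szlenk_set \<alpha> K \<epsilon> = {}) < omega1"
    by (metis (mono_tags, lifting) LeastI_ex)
  then show ?thesis using True by (simp add: szlenk_eta_def)
qed (auto simp: szlenk_eta_def)

lemma szlenk_index_le_iff:
  "szlenk_index TYPE('a::real_normed_vector) \<le> \<gamma> \<longleftrightarrow>
    (\<forall>\<epsilon>>0. szlenk_eta (cball 0 1 :: ('a \<Rightarrow>\<^sub>L real) set) \<epsilon> \<le> \<gamma>)"
  unfolding szlenk_index_def
  by (subst cSUP_le_iff) (auto intro!: bdd_aboveI2[of _ _ omega1] szlenk_eta_le_omega1)


section \<open>Schreier families and Schreier spaces\<close>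

text \<open>
  Throughout, the index set \<open>{1,2,\<dots>}\<close> is the set of positive elements of \<^typ>\<open>nat\<close>.
  For sets of positive integers the next two definitions agree with \<open>max E < min F\<close> and \<open>n \<le> min E\<close>
  under the conventions \<open>min \<emptyset> = \<infinity>\<close>, \<open>max \<emptyset> = 0\<close>.
\<close>

definition set_less :: "nat set \<Rightarrow> nat set \<Rightarrow> bool"
  where "set_less E F \<longleftrightarrow> (\<forall>i\<in>E. \<forall>j\<in>F. i < j)"

definition le_set :: "nat \<Rightarrow> nat set \<Rightarrow> bool"
  where "le_set n E \<longleftrightarrow> (\<forall>i\<in>E. n \<le> i)"

text \<open>
  The chain \<open>m \<le> E\<^sub>1 < \<dots> < E\<^sub>m\<close> means \<open>m \<le> E\<^sub>i\<close> for all \<open>i\<close> and \<open>E\<^sub>i < E\<^sub>j\<close> for all \<open>i < j\<close>. Comparing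
  only consecutive terms would make an empty \<open>E\<^sub>1\<close> cancel the constraint on \<open>m\<close>.
\<close>

definition schreier_step :: "nat set set \<Rightarrow> nat set set"
  where "schreier_step \<S> =
    {\<Union>i\<in>{1..m}. E i | m E. 1 \<le> m \<and> (\<forall>i\<in>{1..m}. E i \<in> \<S> \<and> le_set m (E i)) \<and>
      (\<forall>i\<in>{1..m}. \<forall>j\<in>{1..m}. i < j \<longrightarrow> set_less (E i) (E j))}"

text \<open>
  The choice of sequences: \<open>\<phi> \<alpha> 1, \<phi> \<alpha> 2, \<dots>\<close> is the sequence increasing to the countable limit
  ordinal \<open>\<alpha>\<close>.
\<close>

definition fundamental_sequences :: "(ordinal \<Rightarrow> nat \<Rightarrow> ordinal) \<Rightarrow> bool"
  where "fundamental_sequences \<phi> \<longleftrightarrow>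
    (\<forall>\<alpha><omega1. is_limit \<alpha> \<longrightarrow>
      mono_on {1..} (\<phi> \<alpha>) \<and> (\<forall>n\<ge>1. \<phi> \<alpha> n < \<alpha>) \<and> (SUP n\<in>{1..}. \<phi> \<alpha> n) = \<alpha>)"

definition schreier_family :: "(ordinal \<Rightarrow> nat \<Rightarrow> ordinal) \<Rightarrow> ordinal \<Rightarrow> nat set set"
  where "schreier_family \<phi> \<alpha> =
    ord_rec ({{n} | n. 1 \<le> n} \<union> {{}}) schreier_step
      (\<lambda>\<delta> S. {F. \<exists>n\<ge>1. le_set n F \<and> F \<in> S (\<phi> \<delta> n)}) \<alpha>"

definition c00 :: "(nat \<Rightarrow> real) set"
  where "c00 = {a. finite {n. a n \<noteq> 0} \<and> a 0 = 0}"

definition schreier_norm :: "(ordinal \<Rightarrow> nat \<Rightarrow> ordinal) \<Rightarrow> ordinal \<Rightarrow> (nat \<Rightarrow> real) \<Rightarrow> real"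
  where "schreier_norm \<phi> \<alpha> a = Max ((\<lambda>E. \<Sum>n\<in>E. \<bar>a n\<bar>) ` schreier_family \<phi> \<alpha>)"

definition lin_comb :: "(nat \<Rightarrow> real) \<Rightarrow> (nat \<Rightarrow> 'a::real_vector) \<Rightarrow> 'a"
  where "lin_comb a x = (\<Sum>n | a n \<noteq> 0. a n *\<^sub>R x n)"

text \<open>
  \<open>V\<close>, with the sequence \<open>e 1, e 2, \<dots>\<close>, is the completion of \<open>(c\<^sub>0\<^sub>0, \<parallel>\<cdot>\<parallel>\<^sub>\<alpha>)\<close> with its canonical
  basis: the linear map sending the canonical basis of \<open>c\<^sub>0\<^sub>0\<close> to \<open>e\<close> is isometric, and \<open>V\<close> is the
  closure of its range in the ambient Banach space \<open>'v\<close>. Such a completion exists, see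
  \<open>schreier_space_exists\<close>, and it is unique up to isometric isomorphism.
\<close>

definition schreier_space ::
    "(ordinal \<Rightarrow> nat \<Rightarrow> ordinal) \<Rightarrow> ordinal \<Rightarrow> 'v::banach set \<Rightarrow> (nat \<Rightarrow> 'v) \<Rightarrow> bool"
  where "schreier_space \<phi> \<alpha> V e \<longleftrightarrow>
    (\<forall>a\<in>c00. norm (lin_comb a e) = schreier_norm \<phi> \<alpha> a) \<and> V = closure (span (e ` {1..}))"

lemma schreier_family_props:
  assumes "fundamental_sequences \<phi>" "\<alpha> < omega1"
  shows "{} \<in> schreier_family \<phi> \<alpha> \<and> (\<forall>E\<in>schreier_family \<phi> \<alpha>. finite E \<and> 0 \<notin> E)"
  using assms(2)
proof (induction \<alpha> rule: less_induct)
  case (less \<alpha>)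
  consider "\<alpha> = 0" | \<beta> where "\<alpha> = ord_suc \<beta>" | "is_limit \<alpha>"
    unfolding is_limit_def by blast
  then show ?case
  proof cases
    case 1
    then show ?thesis by (auto simp: schreier_family_def ord_rec_0)
  next
    case (2 \<beta>)
    have eq: "schreier_family \<phi> \<alpha> = schreier_step (schreier_family \<phi> \<beta>)"
      by (simp add: 2 schreier_family_def ord_rec_suc)
    have "\<beta> < \<alpha>" using 2 less_ord_suc by simp
    with less have IH: "{} \<in> schreier_family \<phi> \<beta>" "\<And>E. E \<in> schreier_family \<phi> \<beta> \<Longrightarrow> finite E \<and> 0 \<notin> E"
      by auto
    have "{} \<in> schreier_step (schreier_family \<phi> \<beta>)"
      unfolding schreier_step_def using IH(1)
      by (auto simp: le_set_def set_less_def intro!: exI[of _ 1] exI[of _ "\<lambda>_. {}"])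
    moreover have "finite E \<and> 0 \<notin> E" if "E \<in> schreier_step (schreier_family \<phi> \<beta>)" for E
      using that IH(2) by (auto simp: schreier_step_def)
    ultimately show ?thesis unfolding eq by blast
  next
    case 3
    have lt: "\<phi> \<alpha> n < \<alpha>" if "n \<ge> 1" for n
      using assms(1) less.prems 3 that by (auto simp: fundamental_sequences_def)
    have eq: "schreier_family \<phi> \<alpha> = {F. \<exists>n\<ge>1. le_set n F \<and> F \<in> schreier_family \<phi> (\<phi> \<alpha> n)}"
      using lt by (auto simp: schreier_family_def ord_rec_limit[OF 3])
    have IH: "{} \<in> schreier_family \<phi> (\<phi> \<alpha> n) \<and> (\<forall>E\<in>schreier_family \<phi> (\<phi> \<alpha> n). finite E \<and> 0 \<notin> E)"
      if "n \<ge> 1" for n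
      using less.IH[OF lt[OF that]] lt[OF that] less.prems by auto
    show ?thesis unfolding eq using IH by (auto simp: le_set_def)
  qed
qed

lemma finite_schreier_sums:
  assumes "fundamental_sequences \<phi>" "\<alpha> < omega1" "finite {n. a n \<noteq> 0}"
  shows "finite ((\<lambda>E. \<Sum>n\<in>E. \<bar>a n :: real\<bar>) ` schreier_family \<phi> \<alpha>)"
proof (rule finite_subset)
  show "(\<lambda>E. \<Sum>n\<in>E. \<bar>a n\<bar>) ` schreier_family \<phi> \<alpha> \<subseteq> (\<lambda>E. \<Sum>n\<in>E. \<bar>a n\<bar>) ` Pow {n. a n \<noteq> 0}"
  proof
    fix s assume "s \<in> (\<lambda>E. \<Sum>n\<in>E. \<bar>a n\<bar>) ` schreier_family \<phi> \<alpha>"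
    then obtain E where E: "E \<in> schreier_family \<phi> \<alpha>" "s = (\<Sum>n\<in>E. \<bar>a n\<bar>)" by blast
    then have "finite E" using schreier_family_props[OF assms(1,2)] by blast
    then have "s = (\<Sum>n\<in>E \<inter> {n. a n \<noteq> 0}. \<bar>a n\<bar>)"
      unfolding E(2) by (intro sum.mono_neutral_right) auto
    then show "s \<in> (\<lambda>E. \<Sum>n\<in>E. \<bar>a n\<bar>) ` Pow {n. a n \<noteq> 0}" by blast
  qed
qed (use assms(3) in simp)

text \<open>
  Existence of the completion, realised inside \<open>\<ell>\<^sub>\<infinity>\<close>. Via the standard encodings of
  pairs and of finite sets, the coordinates are indexed by pairs \<open>(E, F)\<close>: the coordinate of a finitely supported sequence \<open>a\<close> is
  the sum over \<open>E\<close> of \<open>\<plusminus>a n\<close>, with sign \<open>+\<close> on \<open>F\<close> and \<open>-\<close> off \<open>F\<close>, if \<open>E \<in> S\<^sub>\<alpha>\<close>, and \<open>0\<close> otherwise.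
\<close>

instance bcontfun :: (metric_space, banach) banach ..

proposition schreier_space_exists:
  assumes \<phi>: "fundamental_sequences \<phi>" and \<alpha>: "\<alpha> < omega1"
  shows "\<exists>(V :: (nat discrete \<Rightarrow>\<^sub>C real) set) e. schreier_space \<phi> \<alpha> V e"
proof -
  define S where "S = schreier_family \<phi> \<alpha>"
  have S0: "{} \<in> S" and Sfin: "\<And>E. E \<in> S \<Longrightarrow> finite E"
    using schreier_family_props[OF \<phi> \<alpha>] by (auto simp: S_def)
  define EE where "EE k = set_decode (fst (prod_decode (of_discrete k)))" for k
  define FF where "FF k = set_decode (snd (prod_decode (of_discrete k)))" for k
  define g :: "nat \<Rightarrow> nat discrete \<Rightarrow> real" where
    "g j k = (if EE k \<in> S \<and> j \<in> EE k then (if j \<in> FF k then 1 else - 1) else 0)" for j k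
  define e where "e j = Bcontfun (g j)" for j
  have e: "apply_bcontfun (e j) k = g j k" for j k
  proof -
    have "continuous_on UNIV (g j)"
      by (simp add: continuous_on_open_vimage open_discrete)
    then have "g j \<in> bcontfun"
      by (rule bcontfun_normI[where b = 1]) (simp add: g_def)
    then show ?thesis unfolding e_def by (simp add: Bcontfun_inverse)
  qed
  have "norm (lin_comb a e) = schreier_norm \<phi> \<alpha> a" if "a \<in> c00" for a
  proof -
    define A where "A = {n. a n \<noteq> 0}"
    have A: "finite A" using that by (simp add: c00_def A_def)
    have fin: "finite ((\<lambda>E. \<Sum>n\<in>E. \<bar>a n\<bar>) ` S)"
      using finite_schreier_sums[OF \<phi> \<alpha>] A unfolding A_def S_def by blast
    have coord: "apply_bcontfun (lin_comb a e) k = (\<Sum>n\<in>A. a n * g n k)" for k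
    proof -
      have "apply_bcontfun (\<Sum>n\<in>B. a n *\<^sub>R e n) k = (\<Sum>n\<in>B. a n * g n k)" if "finite B" for B
        using that by (induction B rule: finite_induct) (auto simp: e)
      then show ?thesis using A by (simp add: lin_comb_def A_def)
    qed
    have sumE: "(\<Sum>n\<in>A. a n * g n k) = (\<Sum>n\<in>EE k. a n * (if n \<in> FF k then 1 else - 1))"
      if "EE k \<in> S" for k
    proof -
      have "(\<Sum>n\<in>A. a n * g n k) = (\<Sum>n\<in>A \<inter> EE k. a n * (if n \<in> FF k then 1 else - 1))"
        using A that by (intro sum.mono_neutral_cong_right) (auto simp: g_def)
      also have "\<dots> = (\<Sum>n\<in>EE k. a n * (if n \<in> FF k then 1 else - 1))"
        using Sfin[OF that] by (intro sum.mono_neutral_left) (auto simp: A_def)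
      finally show ?thesis .
    qed
    show ?thesis
    proof (rule antisym)
      show "norm (lin_comb a e) \<le> schreier_norm \<phi> \<alpha> a"
      proof (rule norm_bound)
        fix k
        show "norm (apply_bcontfun (lin_comb a e) k) \<le> schreier_norm \<phi> \<alpha> a"
        proof (cases "EE k \<in> S")
          case True
          have "\<bar>\<Sum>n\<in>EE k. a n * (if n \<in> FF k then 1 else - 1)\<bar> \<le> (\<Sum>n\<in>EE k. \<bar>a n\<bar>)"
            by (rule order_trans[OF sum_abs]) (auto intro!: sum_mono)
          also have "\<dots> \<le> schreier_norm \<phi> \<alpha> a"
            unfolding schreier_norm_def using fin True by (intro Max_ge) (auto simp: S_def)
          finally show ?thesis by (simp add: coord sumE[OF True])
        next
          case False
          have "0 \<le> schreier_norm \<phi> \<alpha> a"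
            unfolding schreier_norm_def
            by (rule Max_ge) (use fin S0 in \<open>auto simp: S_def intro!: image_eqI[of _ _ "{}"]\<close>)
          then show ?thesis using False by (simp add: coord g_def)
        qed
      qed
      have "schreier_norm \<phi> \<alpha> a \<in> (\<lambda>E. \<Sum>n\<in>E. \<bar>a n\<bar>) ` S"
        unfolding schreier_norm_def S_def[symmetric] using fin S0 by (intro Max_in) auto
      then obtain E where E: "E \<in> S" "schreier_norm \<phi> \<alpha> a = (\<Sum>n\<in>E. \<bar>a n\<bar>)" by blast
      define F where "F = {n\<in>E. a n > 0}"
      define k where "k = discrete (prod_encode (set_encode E, set_encode F))"
      have k: "EE k = E" "FF k = F"
        using Sfin[OF E(1)] by (auto simp: EE_def FF_def k_def F_def discrete_inverse)
      have "(\<Sum>n\<in>E. \<bar>a n\<bar>) = (\<Sum>n\<in>E. a n * (if n \<in> F then 1 else - 1))"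
        by (intro sum.cong) (auto simp: F_def)
      also have "\<dots> = apply_bcontfun (lin_comb a e) k"
        using sumE[of k] E(1) by (simp add: coord k)
      also have "\<dots> \<le> norm (lin_comb a e)"
        using norm_bounded[of "lin_comb a e" k] by simp
      finally show "schreier_norm \<phi> \<alpha> a \<le> norm (lin_comb a e)" using E(2) by simp
    qed
  qed
  then show ?thesis unfolding schreier_space_def by blast
qed


section \<open>Upper tree estimates\<close>

text \<open>Sequences are indexed by \<open>1, 2, \<dots>\<close>; their value at \<open>0\<close> is irrelevant.\<close>

definition dominated ::
    "real \<Rightarrow> (nat \<Rightarrow> 'a::real_normed_vector) \<Rightarrow> (nat \<Rightarrow> 'v::real_normed_vector) \<Rightarrow> bool"
  where "dominated C x f \<longleftrightarrow> (\<forall>a\<in>c00. norm (lin_comb a x) \<le> C * norm (lin_comb a f))"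

definition T_fin :: "nat \<Rightarrow> nat list set"
  where "T_fin l = {t. length t = l \<and> sorted_wrt (<) t \<and> (\<forall>k\<in>set t. 1 \<le> k)}"

text \<open>
  An even tree is given by a function on lists, of which only the values on lists in \<open>T_fin (2 * l)\<close>,
  \<open>l \<ge> 1\<close>, matter.
\<close>

definition normalized_tree :: "(nat list \<Rightarrow> 'a::real_normed_vector) \<Rightarrow> bool"
  where "normalized_tree x \<longleftrightarrow> (\<forall>l\<ge>1. \<forall>t\<in>T_fin (2 * l). norm (x t) = 1)"

definition weakly_null :: "(nat \<Rightarrow> 'a::real_normed_vector) \<Rightarrow> bool"
  where "weakly_null y \<longleftrightarrow> (\<forall>f :: 'a \<Rightarrow>\<^sub>L real. (\<lambda>k. blinfun_apply f (y k)) \<longlonglongrightarrow> 0)"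

text \<open>
  The node at \<open>t\<close> consists of the \<open>x (t @ [k])\<close> with \<open>k > last t\<close>; the finitely many other \<open>k\<close> do not affect
  weak convergence.
\<close>

definition weakly_null_tree :: "(nat list \<Rightarrow> 'a::real_normed_vector) \<Rightarrow> bool"
  where "weakly_null_tree x \<longleftrightarrow>
    (\<forall>n\<ge>1. \<forall>t\<in>T_fin (2 * n - 1). weakly_null (\<lambda>k. x (t @ [k])))"

text \<open>
  In the conclusion, \<open>k 1 < k 2 < \<dots>\<close> determines a branch, whose \<open>n\<close>-th vector is
  \<open>x [k 1, \<dots>, k (2 * n)]\<close>.
\<close>

definition upper_tree_estimates_const ::
    "'a::banach itself \<Rightarrow> real \<Rightarrow> (nat \<Rightarrow> 'v::banach) \<Rightarrow> bool"
  where "upper_tree_estimates_const _ C v \<longleftrightarrow>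
    (\<forall>x :: nat list \<Rightarrow> 'a. normalized_tree x \<and> weakly_null_tree x \<longrightarrow>
      (\<exists>k :: nat \<Rightarrow> nat. strict_mono_on {1..} k \<and> 1 \<le> k 1 \<and>
        dominated C (\<lambda>n. x (map k [1..<2 * n + 1])) (\<lambda>n. v (k (2 * n - 1)))))"

definition upper_tree_estimates :: "'a::banach itself \<Rightarrow> (nat \<Rightarrow> 'v::banach) \<Rightarrow> bool"
  where "upper_tree_estimates X v \<longleftrightarrow> (\<exists>C\<ge>1. upper_tree_estimates_const X C v)"

definition infinite_dimensional :: "'a::real_vector itself \<Rightarrow> bool"
  where "infinite_dimensional _ \<longleftrightarrow> (\<nexists>B :: 'a set. finite B \<and> span B = UNIV)"

end

theory Submission
  imports Defs
begin

text \<open>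
  Fix a normalized weakly null even tree. A branch is sought along which, for every functional
  \<open>f\<close> in the dual ball and every \<open>j \<ge> 1\<close>, the indices \<open>n \<ge> j\<close> with \<open>\<bar>f (x\<^sub>n)\<bar> \<ge> 2\<^sup>-\<^sup>j\<close> are sent by
  \<open>n \<mapsto> k\<^sub>2\<^sub>n\<^sub>-\<^sub>1\<close> to a member of the Schreier family \<open>S\<^sub>\<alpha>\<close>. This suffices: the sum of \<open>\<bar>a\<^sub>n\<bar>\<close> over all
  \<open>n\<close> with \<open>\<bar>f (x\<^sub>n)\<bar> \<ge> 2\<^sup>-\<^sup>j\<close> is then at most \<open>j\<close> times the Schreier norm, since the indices below
  \<open>j\<close> contribute as singletons, and \<open>\<Sum>\<^sub>j j 2\<^sup>-\<^sup>j = 2\<close> gives domination with constant \<open>4\<close>, which does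
  not depend on the tree (\<open>norm_lin_comb_le\<close>).

  Sets of large coordinates are measured by a Szlenk rank. Write \<open>P\<^sub>\<xi>\<close> for the \<open>\<xi>\<close>-th derived set of
  the dual ball. For a weak-star closed \<open>K\<close> whose intersection with the ball is nonempty, compactness
  makes the least \<open>\<beta>\<close> with \<open>P\<^sub>\<beta> \<inter> K = {}\<close> a successor \<open>\<xi> + 1\<close>; call \<open>\<xi>\<close> the rank of \<open>K\<close>. The functionals
  in \<open>P\<^sub>\<xi> \<inter> K\<close> can be covered by finitely many weak-star open sets in which \<open>P\<^sub>\<xi>\<close> has small diameter, so
  a weakly null sequence \<open>(y\<^sub>k)\<close> in the unit ball is eventually uniformly small on \<open>P\<^sub>\<xi> \<inter> K\<close>
  (\<open>eventually_small_off_szlenk_derivation\<close>). Hence for large \<open>k\<close> the set of \<open>f \<in> K\<close> for which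
  \<open>\<bar>f (y\<^sub>k)\<bar>\<close> is large has smaller rank than \<open>K\<close>, or misses the ball. The ball itself has rank below
  \<open>\<omega>\<^sup>\<alpha>\<close>, so each set of large coordinates comes with a strictly decreasing sequence of ordinals that
  starts below \<open>\<omega>\<^sup>\<alpha>\<close>.

  The Schreier family is rich enough for such descents: if integers and ordinals are chosen in turn,
  where each integer is allowed to be large depending on the ordinals chosen so far and the ordinals
  decrease strictly from an ordinal below \<open>\<omega>\<^sup>\<alpha>\<close>, then the integers can be made to form a set in
  \<open>S\<^sub>\<alpha>\<close> (\<open>schreier_family_accommodates\<close>). Along the tree the two choices alternate in exactly this
  order: \<open>k\<^sub>2\<^sub>n\<^sub>-\<^sub>1\<close> is chosen large for the ranks of the finitely many sets of coordinates seen so far,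
  and then \<open>k\<^sub>2\<^sub>n\<close> is chosen far out in the weakly null node to make the ranks drop. Level \<open>j\<close> ignores
  the coordinates before \<open>j\<close>, so only finitely many levels are active at each stage.
\<close>

section \<open>Ordinal arithmetic\<close>

lemma bdd_above_image_lessThan_ordinal:
  fixes f :: "ordinal \<Rightarrow> ordinal"
  shows "bdd_above (f ` {..<\<delta>})"
  by (rule bdd_above_ordinal)
     (rule ordLeq_transitive[OF card_of_image
        ordLeq_transitive[OF card_of_mono1 card_atMost_ordinal[of \<delta>]]], auto)

lemma less_SUP_lessThan_iff:
  fixes f :: "ordinal \<Rightarrow> ordinal"
  assumes "is_limit \<delta>"
  shows "\<zeta> < (SUP \<gamma>\<in>{..<\<delta>}. f \<gamma>) \<longleftrightarrow> (\<exists>\<gamma><\<delta>. \<zeta> < f \<gamma>)"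
proof -
  have "0 < \<delta>"
    using assms by (metis is_limit_def order_le_less zero_le_ordinal)
  then show ?thesis
    by (subst less_cSUP_iff) (auto simp: bdd_above_image_lessThan_ordinal)
qed

text \<open>
  Sums, products and powers are transfinite recursions that take suprema at limits. Below, such
  a limit value is only ever used through the ordinals smaller than it.
\<close>

lemma less_ord_rec_SUP_iff:
  fixes \<zeta> :: ordinal
  assumes "is_limit \<delta>"
  shows "\<zeta> < ord_rec z s (\<lambda>\<delta> f. SUP \<gamma>\<in>{..<\<delta>}. f \<gamma>) \<delta> \<longleftrightarrow>
    (\<exists>\<gamma><\<delta>. \<zeta> < ord_rec z s (\<lambda>\<delta> f. SUP \<gamma>\<in>{..<\<delta>}. f \<gamma>) \<gamma>)"
proof -
  let ?f = "ord_rec z s (\<lambda>\<delta> f. SUP \<gamma>\<in>{..<\<delta>}. f \<gamma>)"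
  have "?f \<delta> = (SUP \<gamma>\<in>{..<\<delta>}. ?f \<gamma>)"
    unfolding ord_rec_limit[OF assms] by (rule SUP_cong) auto
  then show ?thesis
    by (simp only: less_SUP_lessThan_iff[OF assms])
qed

lemma less_ord_suc_iff: "\<zeta> < ord_suc \<beta> \<longleftrightarrow> \<zeta> \<le> \<beta>"
  by (meson less_ord_suc not_less ord_suc_le order_le_less_trans)

lemma ord_suc_less_limit: "is_limit \<delta> \<Longrightarrow> \<gamma> < \<delta> \<Longrightarrow> ord_suc \<gamma> < \<delta>"
  by (metis is_limit_def ord_suc_le order_le_less)

lemma ordinal_cases:
  obtains (zero) "\<alpha> = 0" | (suc) \<beta> where "\<alpha> = ord_suc \<beta>" | (limit) "is_limit \<alpha>"
  unfolding is_limit_def by blast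

lemma ordinal_induct [case_names zero suc limit]:
  assumes "P 0" and "\<And>\<beta>. P \<beta> \<Longrightarrow> P (ord_suc \<beta>)"
    and "\<And>\<beta>. is_limit \<beta> \<Longrightarrow> (\<And>\<gamma>. \<gamma> < \<beta> \<Longrightarrow> P \<gamma>) \<Longrightarrow> P \<beta>"
  shows "P \<alpha>"
proof (induction \<alpha> rule: less_induct)
  case (less \<alpha>)
  show ?case
    by (cases \<alpha> rule: ordinal_cases) (use assms less less_ord_suc in auto)
qed

lemma not_less_zero_ordinal [simp]: "\<not> (\<zeta>::ordinal) < 0"
  by (simp add: not_less)

lemma ordinal_add_0: "\<delta> + 0 = (\<delta>::ordinal)"
  and ordinal_add_suc: "\<delta> + ord_suc \<rho> = ord_suc (\<delta> + \<rho>)"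
  and less_ordinal_add_limit: "is_limit \<rho> \<Longrightarrow> \<zeta> < \<delta> + \<rho> \<longleftrightarrow> (\<exists>\<gamma><\<rho>. \<zeta> < \<delta> + \<gamma>)"
  by (simp_all only: plus_ordinal_def ord_rec_0 ord_rec_suc less_ord_rec_SUP_iff)

lemma ordinal_mult_0: "\<gamma> * 0 = (0::ordinal)"
  and ordinal_mult_suc: "\<gamma> * ord_suc \<nu> = \<gamma> * \<nu> + \<gamma>"
  and less_ordinal_mult_limit: "is_limit \<nu> \<Longrightarrow> \<zeta> < \<gamma> * \<nu> \<longleftrightarrow> (\<exists>\<mu><\<nu>. \<zeta> < \<gamma> * \<mu>)"
  by (simp_all only: times_ordinal_def ord_rec_0 ord_rec_suc less_ord_rec_SUP_iff)

lemma ord_pow_0: "ord_pow \<gamma> 0 = 1"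
  and ord_pow_suc: "ord_pow \<gamma> (ord_suc \<beta>) = ord_pow \<gamma> \<beta> * \<gamma>"
  and less_ord_pow_limit: "is_limit \<beta> \<Longrightarrow> \<zeta> < ord_pow \<gamma> \<beta> \<longleftrightarrow> (\<exists>\<mu><\<beta>. \<zeta> < ord_pow \<gamma> \<mu>)"
  by (simp_all only: ord_pow_def ord_rec_0 ord_rec_suc less_ord_rec_SUP_iff)

lemma less_ordinal_addE:
  assumes "\<zeta> < \<delta> + (\<rho>::ordinal)"
  obtains "\<zeta> < \<delta>" | \<rho>' where "\<rho>' < \<rho>" "\<zeta> = \<delta> + \<rho>'"
proof -
  have "\<zeta> < \<delta> \<or> (\<exists>\<rho>'<\<rho>. \<zeta> = \<delta> + \<rho>')"
    using assms
  proof (induction \<rho> rule: ordinal_induct)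
    case zero
    then show ?case by (simp add: ordinal_add_0)
  next
    case (suc \<rho>)
    then show ?case
      by (metis less_ord_suc less_ord_suc_iff ordinal_add_suc order_le_less order_less_trans)
  next
    case (limit \<rho>)
    then obtain \<gamma> where \<gamma>: "\<gamma> < \<rho>" "\<zeta> < \<delta> + \<gamma>"
      using less_ordinal_add_limit by blast
    from limit.IH[OF this] show ?case
      using \<gamma>(1) by (blast intro: order_less_trans)
  qed
  then show ?thesis using that by blast
qed

lemma ordinal_le_add: "\<rho> \<le> \<delta> + (\<rho>::ordinal)"
proof (induction \<rho> rule: ordinal_induct)
  case (suc \<rho>)
  then show ?case
    by (metis less_ord_suc_iff ord_suc_le ordinal_add_suc)
next
  case (limit \<rho>)
  have "\<zeta> < \<delta> + \<rho>" if "\<zeta> < \<rho>" for \<zeta>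
    using limit that ord_suc_less_limit less_ord_suc less_ordinal_add_limit
    by (meson order_less_le_trans)
  then show ?case by (meson less_irrefl not_le_imp_less)
qed simp

lemma infinite_lessThan_limit: "is_limit \<nu> \<Longrightarrow> infinite {..<\<nu>}"
proof
  assume \<nu>: "is_limit \<nu>" and fin: "finite {..<\<nu>}"
  have "{..<\<nu>} \<noteq> {}"
    using \<nu> by (metis is_limit_def lessThan_iff empty_iff order_le_less zero_le_ordinal)
  then have "Max {..<\<nu>} < \<nu>" using fin Max_in by blast
  then have "ord_suc (Max {..<\<nu>}) < \<nu>" by (rule ord_suc_less_limit[OF \<nu>])
  then have "ord_suc (Max {..<\<nu>}) \<le> Max {..<\<nu>}" using fin by simp
  then show False using less_ord_suc leD by blast
qed

lemma ex_infinite_lessThan: "\<exists>\<alpha>::ordinal. infinite {..<\<alpha>}"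
  using ex_uncountable_lessThan countable_finite by blast

lemma infinite_lessThan_omega0: "infinite {..<omega0}"
  unfolding omega0_def using ex_infinite_lessThan by (rule LeastI_ex)

lemma less_omega0D: "\<nu> < omega0 \<Longrightarrow> finite {..<\<nu>}"
  unfolding omega0_def using not_less_Least by blast

lemma is_limit_omega0: "is_limit omega0"
proof -
  have "omega0 \<noteq> 0"
    using infinite_lessThan_omega0 by (auto simp: lessThan_def)
  moreover have "omega0 \<noteq> ord_suc \<beta>" for \<beta>
  proof
    assume *: "omega0 = ord_suc \<beta>"
    then have "{..<omega0} \<subseteq> insert \<beta> {..<\<beta>}"
      by (auto simp only: * subset_iff lessThan_iff insert_iff less_ord_suc_iff order_le_less)
    moreover have "finite {..<\<beta>}"
      unfolding * by (rule less_omega0D) (simp only: * less_ord_suc)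
    ultimately show False
      using infinite_lessThan_omega0 finite_subset by blast
  qed
  ultimately show ?thesis unfolding is_limit_def by blast
qed

lemma ord_pow_omega0_mono: "\<beta> \<le> \<beta>' \<Longrightarrow> ord_pow omega0 \<beta> \<le> ord_pow omega0 \<beta>'"
proof (induction \<beta>' rule: ordinal_induct)
  case zero
  then have "\<beta> = 0" by (simp add: antisym)
  then show ?case by simp
next
  case (suc \<beta>')
  let ?p = "ord_pow omega0 \<beta>'"
  have one: "ord_suc 0 < omega0"
    using is_limit_omega0 by (metis is_limit_def ord_suc_less_limit order_le_less zero_le_ordinal)
  have "?p \<le> ?p * ord_suc 0"
    by (simp add: ordinal_mult_suc ordinal_le_add)
  also have "\<dots> \<le> ?p * omega0"
    using one less_ordinal_mult_limit[OF is_limit_omega0] by (meson less_irrefl not_le_imp_less)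
  finally have step: "?p \<le> ord_pow omega0 (ord_suc \<beta>')"
    by (simp add: ord_pow_suc)
  show ?case
  proof (cases "\<beta> = ord_suc \<beta>'")
    case False
    then have "\<beta> \<le> \<beta>'"
      using suc.prems by (metis less_ord_suc_iff order_le_less)
    then show ?thesis using suc.IH step order_trans by blast
  qed simp
next
  case (limit \<beta>')
  have "\<zeta> < ord_pow omega0 \<beta>'" if "\<beta> < \<beta>'" "\<zeta> < ord_pow omega0 \<beta>" for \<zeta>
    unfolding less_ord_pow_limit[OF limit.hyps(1)] using that by blast
  then show ?case
    using limit.prems by (metis less_irrefl not_le_imp_less order_le_less)
qed

text \<open>Needed because \<^const>\<open>szlenk_eta\<close> returns \<^const>\<open>omega1\<close> when no derived set vanishes: a bound
  by a countable power of \<open>\<omega>\<close> then excludes this case.\<close>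

lemma ord_pow_omega0_less_omega1:
  assumes "\<beta> < omega1"
  shows "ord_pow omega0 \<beta> < omega1"
proof -
  have "card {..<\<mu>} < card {..<\<nu>}" if "\<mu> < \<nu>" "\<nu> < omega0" for \<mu> \<nu> :: ordinal
    by (rule psubset_card_mono) (use that less_omega0D in auto)
  then have "inj_on (\<lambda>\<nu>. card {..<\<nu>}) {..<omega0}"
    by (intro inj_onI) (metis lessThan_iff less_irrefl linorder_less_linear)
  then have omega: "countable {..<omega0}" by (rule countableI')
  have add: "countable {..<\<delta> + \<rho>}" if "countable {..<\<delta>}" "countable {..<\<rho>}" for \<delta> \<rho> :: ordinal
  proof (rule countable_subset)
    show "{..<\<delta> + \<rho>} \<subseteq> {..<\<delta>} \<union> (+) \<delta> ` {..<\<rho>}"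
      by (auto elim: less_ordinal_addE)
  qed (use that in auto)
  have mult: "countable {..<\<gamma> * \<nu>}" if "countable {..<\<gamma>}" "countable {..<\<nu>}" for \<gamma> \<nu> :: ordinal
    using that(2)
  proof (induction \<nu> rule: ordinal_induct)
    case zero
    then show ?case by (simp add: ordinal_mult_0)
  next
    case (suc \<nu>)
    then have "countable {..<\<nu>}"
      using less_ord_suc by (meson countable_subset lessThan_subset_iff less_imp_le)
    with suc.IH show ?case by (simp add: ordinal_mult_suc add that(1))
  next
    case (limit \<nu>)
    then have "countable {..<\<mu>}" if "\<mu> < \<nu>" for \<mu>
      using that by (meson countable_subset lessThan_subset_iff less_imp_le)
    then have "countable (\<Union>\<mu>\<in>{..<\<nu>}. {..<\<gamma> * \<mu>})"
      using limit by (intro countable_UN) auto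
    moreover have "{..<\<gamma> * \<nu>} = (\<Union>\<mu>\<in>{..<\<nu>}. {..<\<gamma> * \<mu>})"
      using limit by (auto simp: less_ordinal_mult_limit)
    ultimately show ?case by simp
  qed
  have "countable {..<ord_pow omega0 \<beta>}"
    using assms
  proof (induction \<beta> rule: ordinal_induct)
    case zero
    have "{..<1::ordinal} = {0}"
      by (auto simp: one_ordinal_def less_ord_suc_iff antisym)
    then show ?case by (simp add: ord_pow_0)
  next
    case (suc \<beta>)
    then have "\<beta> < omega1" using less_ord_suc order_less_trans by blast
    from mult[OF suc.IH[OF this] omega] show ?case by (simp only: ord_pow_suc)
  next
    case (limit \<beta>)
    then have "countable (\<Union>\<mu>\<in>{..<\<beta>}. {..<ord_pow omega0 \<mu>})"
      by (intro countable_UN) (auto simp: less_omega1_iff[symmetric])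
    moreover have "{..<ord_pow omega0 \<beta>} = (\<Union>\<mu>\<in>{..<\<beta>}. {..<ord_pow omega0 \<mu>})"
      using limit by (auto simp: less_ord_pow_limit)
    ultimately show ?case by simp
  qed
  then show ?thesis by (simp add: less_omega1_iff)
qed

section \<open>Descents of ordinals and Schreier families\<close>

text \<open>
  What remains of a family after \<open>m\<close> has been played as the next, smallest element.
\<close>

definition residual :: "nat \<Rightarrow> nat set set \<Rightarrow> nat set set"
  where "residual m F = {E. (\<forall>i\<in>E. m < i) \<and> insert m E \<in> F}"

text \<open>
  A winning strategy for building a member of \<open>F\<close>: first an integer \<open>m\<close> is chosen, with a lower
  bound \<open>N\<close> depending on \<open>\<xi>\<close> and \<open>F\<close>, then an opponent passes to an ordinal \<open>\<zeta> < \<xi>\<close>, and so on. The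
  game may be stopped at any time, whence the empty set is required at each position. The bound
  \<open>N\<close> serves all \<open>\<zeta>\<close> at once because the integer is chosen before the ordinal is known.
\<close>

inductive accommodates :: "nat set set \<Rightarrow> ordinal \<Rightarrow> bool" where
  accommodatesI: "{} \<in> F \<Longrightarrow> \<exists>N. \<forall>m\<ge>N. \<forall>\<zeta><\<xi>. accommodates (residual m F) \<zeta> \<Longrightarrow> accommodates F \<xi>"

lemma accommodates_mono:
  assumes "accommodates F \<xi>" "F \<subseteq> G" "\<xi>' \<le> \<xi>"
  shows "accommodates G \<xi>'"
  using assms
proof (induction arbitrary: G \<xi>')
  case (accommodatesI F \<xi>)
  from accommodatesI.IH obtain N where N: "\<forall>m\<ge>N. \<forall>\<zeta><\<xi>. accommodates (residual m F) \<zeta> \<and>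
      (\<forall>G. residual m F \<subseteq> G \<longrightarrow> (\<forall>\<xi>'\<le>\<zeta>. accommodates G \<xi>'))"
    by auto
  have "accommodates (residual m G) \<zeta>" if "m \<ge> N" "\<zeta> < \<xi>'" for m \<zeta>
  proof -
    have "residual m F \<subseteq> residual m G"
      using accommodatesI.prems by (auto simp: residual_def)
    then show ?thesis
      using N that accommodatesI.prems by (meson order_less_le_trans order_refl)
  qed
  then show ?case
    using accommodatesI.hyps accommodatesI.prems by (intro accommodates.intros) auto
qed

lemma accommodates_le_set:
  assumes "accommodates F \<xi>"
  shows "accommodates {E \<in> F. le_set n E} \<xi>"
  using assms
proof cases
  case accommodatesI
  then obtain N where N: "\<And>m \<zeta>. m \<ge> N \<Longrightarrow> \<zeta> < \<xi> \<Longrightarrow> accommodates (residual m F) \<zeta>"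
    by blast
  have "accommodates (residual m {E \<in> F. le_set n E}) \<zeta>" if "m \<ge> max N n" "\<zeta> < \<xi>" for m \<zeta>
    by (rule accommodates_mono[OF N[of m \<zeta>]]) (use that in \<open>fastforce simp: residual_def le_set_def\<close>)+
  then show ?thesis
    using accommodatesI(1) by (intro accommodates.intros exI[of _ "max N n"]) (auto simp: le_set_def)
qed

text \<open>
  This is \<open>S\<^sub>0\<close>.
\<close>

definition singletons :: "nat set set"
  where "singletons = {{n} | n. 1 \<le> n} \<union> {{}}"

text \<open>
  The middle set \<open>S\<close> has room for the one integer that is played when the descent crosses from
  ordinals \<open>\<ge> \<delta>\<close> to ordinals below \<open>\<delta>\<close>, in \<open>accommodates_glue\<close>.
\<close>

definition glue :: "nat set set \<Rightarrow> nat set set \<Rightarrow> nat set set"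
  where "glue F G = {E \<union> S \<union> H | E S H. E \<in> F \<and> S \<in> singletons \<and> H \<in> G \<and>
    set_less E S \<and> set_less S H \<and> set_less E H}"

text \<open>
  A descent from \<open>\<delta> + \<rho>\<close> goes through ordinals \<open>\<delta> + \<rho>'\<close> with \<open>\<rho>' < \<rho>\<close>, which \<open>F\<close> takes care of,
  and then jumps below \<open>\<delta>\<close>, where \<open>G\<close> takes over. The integer answered by the jump was chosen with
  the strategy for \<open>F\<close> but need not extend the set in \<open>F\<close>; it goes into the middle singleton.
\<close>

lemma accommodates_glue:
  assumes "accommodates F \<rho>" "{} \<in> G" "\<And>\<zeta>. \<zeta> < \<delta> \<Longrightarrow> accommodates G \<zeta>"
  shows "accommodates (glue F G) (\<delta> + \<rho>)"
  using assms(1)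
proof induction
  case (accommodatesI F \<rho>)
  then obtain N where N: "\<And>m \<zeta>. m \<ge> N \<Longrightarrow> \<zeta> < \<rho> \<Longrightarrow> accommodates (glue (residual m F) G) (\<delta> + \<zeta>)"
    by blast
  have "accommodates (residual m (glue F G)) \<zeta>" if m: "m \<ge> max N 1" and \<zeta>: "\<zeta> < \<delta> + \<rho>" for m \<zeta>
    using \<zeta>
  proof (cases rule: less_ordinal_addE)
    case 1
    have "{H \<in> G. le_set (Suc m) H} \<subseteq> residual m (glue F G)"
    proof
      fix H assume H: "H \<in> {H \<in> G. le_set (Suc m) H}"
      \<comment> \<open>the opponent jumps below \<open>\<delta>\<close>: \<open>m\<close> becomes the middle singleton\<close>
      then have "{} \<union> {m} \<union> H \<in> glue F G"
        unfolding glue_def using accommodatesI.hyps m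
        by (intro CollectI exI[of _ "{}"] exI[of _ "{m}"] exI[of _ H])
           (auto simp: singletons_def set_less_def le_set_def)
      then show "H \<in> residual m (glue F G)"
        using H by (auto simp: residual_def le_set_def)
    qed
    with accommodates_le_set[OF assms(3)[OF 1]] show ?thesis
      by (rule accommodates_mono) simp
  next
    case (2 \<rho>')
    have "{E \<in> glue (residual m F) G. le_set (Suc m) E} \<subseteq> residual m (glue F G)"
    proof
      fix D assume "D \<in> {E \<in> glue (residual m F) G. le_set (Suc m) E}"
      then obtain E S H where D: "D = E \<union> S \<union> H" "E \<in> residual m F" "S \<in> singletons" "H \<in> G"
        "set_less E S" "set_less S H" "set_less E H" "le_set (Suc m) D"
        unfolding glue_def by blast
      then have "insert m E \<union> S \<union> H \<in> glue F G"
        unfolding glue_def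
        by (intro CollectI exI[of _ "insert m E"] exI[of _ S] exI[of _ H])
           (auto simp: set_less_def le_set_def residual_def Suc_le_eq)
      then show "D \<in> residual m (glue F G)"
        using D by (auto simp: residual_def le_set_def Suc_le_eq)
    qed
    moreover have "accommodates {E \<in> glue (residual m F) G. le_set (Suc m) E} \<zeta>"
      unfolding 2(2) by (rule accommodates_le_set[OF N]) (use m 2 in auto)
    ultimately show ?thesis
      by (simp add: accommodates_mono)
  qed
  moreover have "{} \<in> glue F G"
    using accommodatesI.hyps assms(2)
    by (auto simp: glue_def singletons_def set_less_def)
  ultimately show ?case by (intro accommodates.intros) blast+
qed

text \<open>
  Unions of consecutive members of \<open>\<S>\<close> and singletons, in alternation: \<open>p + 1\<close> members and \<open>p\<close>
  singletons, hence \<open>2p + 1\<close> members in total if \<open>\<S>\<close> contains the singletons.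
\<close>

primrec blocks :: "nat set set \<Rightarrow> nat \<Rightarrow> nat set set" where
  "blocks \<S> 0 = \<S>"
| "blocks \<S> (Suc p) = glue \<S> (blocks \<S> p)"

lemma blocks_decompose:
  assumes "singletons \<subseteq> \<S>" "E \<in> blocks \<S> p"
  shows "\<exists>D. E = (\<Union>i\<in>{1..2 * p + 1}. D i) \<and> (\<forall>i\<in>{1..2 * p + 1}. D i \<in> \<S>) \<and>
    (\<forall>i\<in>{1..2 * p + 1}. \<forall>j\<in>{1..2 * p + 1}. i < j \<longrightarrow> set_less (D i) (D j))"
  using assms(2)
proof (induction p arbitrary: E)
  case 0
  then show ?case by (intro exI[of _ "\<lambda>_. E"]) auto
next
  case (Suc p)
  then obtain A S H where E: "E = A \<union> S \<union> H" "A \<in> \<S>" "S \<in> singletons" "H \<in> blocks \<S> p"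
    "set_less A S" "set_less S H" "set_less A H"
    unfolding blocks.simps glue_def by blast
  from Suc.IH[OF E(4)] obtain D where D: "H = (\<Union>i\<in>{1..2 * p + 1}. D i)"
    "\<And>i. i \<in> {1..2 * p + 1} \<Longrightarrow> D i \<in> \<S>"
    "\<And>i j. i \<in> {1..2 * p + 1} \<Longrightarrow> j \<in> {1..2 * p + 1} \<Longrightarrow> i < j \<Longrightarrow> set_less (D i) (D j)"
    by blast
  define D' where "D' i = (if i = 1 then A else if i = 2 then S else D (i - 2))" for i :: nat
  have D': "D' 1 = A" "D' 2 = S" "\<And>i. i \<in> {1..2 * p + 1} \<Longrightarrow> D' (i + 2) = D i"
    by (auto simp: D'_def)
  have idx: "{1..2 * Suc p + 1} = insert 1 (insert 2 ((\<lambda>i. i + 2) ` {1..2 * p + 1}))"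
    by (auto simp: image_iff) presburger
  have cases_idx: thesis
    if "i \<in> {1..2 * Suc p + 1}" "i = 1 \<Longrightarrow> thesis" "i = 2 \<Longrightarrow> thesis"
      "\<And>l. l \<in> {1..2 * p + 1} \<Longrightarrow> i = l + 2 \<Longrightarrow> thesis" for i thesis
    using that unfolding idx by blast
  have H: "set_less S (D i)" "set_less A (D i)" if "i \<in> {1..2 * p + 1}" for i
    using E(6,7) D(1) that unfolding set_less_def by blast+
  show ?case
  proof (intro exI[of _ D'] conjI ballI impI)
    have "(\<Union>i\<in>{1..2 * p + 1}. D' (i + 2)) = H"
      unfolding D(1) by (rule SUP_cong) (simp_all only: D')
    then show "E = (\<Union>i\<in>{1..2 * Suc p + 1}. D' i)"
      unfolding idx E(1) by (simp only: UN_insert image_image D' Un_assoc)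
    fix i assume i: "i \<in> {1..2 * Suc p + 1}"
    show "D' i \<in> \<S>"
      using i by (rule cases_idx) (use assms(1) E(2,3) D(2) D' in \<open>auto simp only: subset_iff\<close>)
    fix j assume j: "j \<in> {1..2 * Suc p + 1}" and less: "i < j"
    show "set_less (D' i) (D' j)"
    proof (rule cases_idx[OF i]; rule cases_idx[OF j])
      fix l l' assume "l \<in> {1..2 * p + 1}" "i = l + 2" "l' \<in> {1..2 * p + 1}" "j = l' + 2"
      then show ?thesis using less D(3)[of l l'] D'(3) by simp
    qed (use less E(5) H D' in \<open>simp_all del: One_nat_def\<close>)
  qed
qed

lemma blocks_in_schreier_step:
  assumes "singletons \<subseteq> \<S>" "E \<in> blocks \<S> p" "le_set (2 * p + 1) E"
  shows "E \<in> schreier_step \<S>"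
proof -
  obtain D where "E = (\<Union>i\<in>{1..2 * p + 1}. D i)" "\<forall>i\<in>{1..2 * p + 1}. D i \<in> \<S>"
    "\<forall>i\<in>{1..2 * p + 1}. \<forall>j\<in>{1..2 * p + 1}. i < j \<longrightarrow> set_less (D i) (D j)"
    using blocks_decompose[OF assms(1,2)] by blast
  then show ?thesis
    unfolding schreier_step_def using assms(3)
    by (intro CollectI exI[of _ "2 * p + 1"] exI[of _ D]) (auto simp: le_set_def)
qed

text \<open>
  For finite \<open>\<nu>\<close> this is \<open>accommodates_glue\<close> applied \<open>\<nu>\<close> times. It covers all ordinals below
  \<open>\<gamma> \<omega>\<close>, which is the successor step for \<open>\<gamma> = \<omega>\<^sup>\<beta>\<close>.
\<close>

lemma blocks_accommodate:
  assumes "{} \<in> \<S>" "\<And>\<xi>. \<xi> < \<gamma> \<Longrightarrow> accommodates \<S> \<xi>" "\<nu> < omega0"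
  shows "\<exists>p. \<forall>\<zeta><\<gamma> * \<nu>. accommodates (blocks \<S> p) \<zeta>"
  using assms(3)
proof (induction \<nu> rule: ordinal_induct)
  case zero
  then show ?case by (simp add: ordinal_mult_0)
next
  case (suc \<nu>)
  have "\<nu> < omega0" using suc.prems less_ord_suc order_less_trans by blast
  from suc.IH[OF this] obtain p where p: "\<And>\<zeta>. \<zeta> < \<gamma> * \<nu> \<Longrightarrow> accommodates (blocks \<S> p) \<zeta>"
    by blast
  have empty: "{} \<in> blocks \<S> p"
    by (induction p) (use assms(1) in \<open>auto simp: glue_def singletons_def set_less_def\<close>)
  have glue: "accommodates (blocks \<S> (Suc p)) (\<gamma> * \<nu> + \<rho>)" if "\<rho> < \<gamma>" for \<rho>
    unfolding blocks.simps using assms(2)[OF that] empty p by (rule accommodates_glue)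
  have "accommodates (blocks \<S> (Suc p)) \<zeta>" if "\<zeta> < \<gamma> * ord_suc \<nu>" for \<zeta>
    using that unfolding ordinal_mult_suc
  proof (cases rule: less_ordinal_addE)
    case 1
    have "{} \<union> {} \<union> H \<in> glue \<S> (blocks \<S> p)" if "H \<in> blocks \<S> p" for H
      unfolding glue_def using that assms(1)
      by (intro CollectI exI[of _ "{}"] exI[of _ H]) (auto simp: singletons_def set_less_def)
    then show ?thesis
      using p[OF 1] by (intro accommodates_mono[OF p[OF 1]]) auto
  qed (use glue in blast)
  then show ?case by blast
next
  case (limit \<nu>)
  then show ?case using less_omega0D infinite_lessThan_limit by blast
qed

lemma schreier_family_0: "schreier_family \<phi> 0 = singletons"
  and schreier_family_suc: "schreier_family \<phi> (ord_suc \<beta>) = schreier_step (schreier_family \<phi> \<beta>)"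
  by (simp_all add: schreier_family_def ord_rec_0 ord_rec_suc singletons_def)

lemma schreier_family_limit:
  assumes "fundamental_sequences \<phi>" "\<beta> < omega1" "is_limit \<beta>"
  shows "schreier_family \<phi> \<beta> = {F. \<exists>n\<ge>1. le_set n F \<and> F \<in> schreier_family \<phi> (\<phi> \<beta> n)}"
proof -
  have "\<phi> \<beta> n < \<beta>" if "n \<ge> 1" for n
    using assms that by (auto simp: fundamental_sequences_def)
  then show ?thesis
    by (auto simp: schreier_family_def ord_rec_limit[OF assms(3)])
qed

lemma singletons_subset_schreier_family:
  assumes "fundamental_sequences \<phi>" "\<beta> < omega1"
  shows "singletons \<subseteq> schreier_family \<phi> \<beta>"
  using assms(2)
proof (induction \<beta> rule: ordinal_induct)
  case zero
  then show ?case by (simp add: schreier_family_0)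
next
  case (suc \<beta>)
  then have IH: "singletons \<subseteq> schreier_family \<phi> \<beta>"
    using less_ord_suc order_less_trans by blast
  show ?case
    unfolding schreier_family_suc
  proof
    fix E assume "E \<in> singletons"
    with IH have "E = (\<Union>i\<in>{1..1::nat}. E)" "E \<in> schreier_family \<phi> \<beta>" "le_set 1 E"
      by (auto simp: singletons_def le_set_def)
    then show "E \<in> schreier_step (schreier_family \<phi> \<beta>)"
      unfolding schreier_step_def by (intro CollectI exI[of _ 1] exI[of _ "\<lambda>_. E"]) auto
  qed
next
  case (limit \<beta>)
  have "\<phi> \<beta> 1 < \<beta>"
    using assms(1) limit by (auto simp: fundamental_sequences_def)
  then have "singletons \<subseteq> schreier_family \<phi> (\<phi> \<beta> 1)"
    using limit order_less_trans by blast
  then show ?case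
    unfolding schreier_family_limit[OF assms(1) limit.prems limit.hyps]
    by (auto simp: singletons_def le_set_def)
qed

text \<open>
  In the successor step an ordinal below \<open>\<omega>\<^sup>\<beta>\<^sup>+\<^sup>1\<close> lies below some \<open>\<omega>\<^sup>\<beta> \<nu>\<close> with \<open>\<nu>\<close> finite, so the
  integers split into boundedly many members of \<open>S\<^sub>\<beta>\<close>; as the first integer may be taken larger than
  their number, the union is in \<open>S\<^sub>\<beta>\<^sub>+\<^sub>1\<close>. In the limit step an ordinal below \<open>\<omega>\<^sup>\<beta>\<close> lies below
  \<open>\<omega>\<close> to the power \<open>\<phi> \<beta> n\<close> for some \<open>n\<close>, and the first integer is taken at least \<open>n\<close>.
\<close>

theorem schreier_family_accommodates:
  assumes "fundamental_sequences \<phi>" "\<beta> < omega1" "\<xi> < ord_pow omega0 \<beta>"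
  shows "accommodates (schreier_family \<phi> \<beta>) \<xi>"
  using assms(2,3)
proof (induction \<beta> arbitrary: \<xi> rule: ordinal_induct)
  case zero
  then have "\<xi> = 0"
    by (simp add: ord_pow_0 one_ordinal_def less_ord_suc_iff antisym)
  then show ?case
    by (intro accommodates.intros) (auto simp: schreier_family_0 singletons_def)
next
  case (suc \<beta>)
  have \<beta>: "\<beta> < omega1" using suc.prems less_ord_suc order_less_trans by blast
  let ?S = "schreier_family \<phi> \<beta>"
  obtain \<nu> where \<nu>: "\<nu> < omega0" "\<xi> < ord_pow omega0 \<beta> * \<nu>"
    using suc.prems less_ordinal_mult_limit[OF is_limit_omega0] by (auto simp: ord_pow_suc)
  have sing: "singletons \<subseteq> ?S"
    by (rule singletons_subset_schreier_family[OF assms(1) \<beta>])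
  then have "{} \<in> ?S" by (auto simp: singletons_def)
  from blocks_accommodate[OF this suc.IH[OF \<beta>] \<nu>(1)] obtain p
    where "accommodates (blocks ?S p) \<xi>"
    using \<nu>(2) by blast
  then show ?case
    unfolding schreier_family_suc
    by (rule accommodates_mono[OF accommodates_le_set[of _ _ "2 * p + 1"]])
       (auto intro: blocks_in_schreier_step[OF sing])
next
  case (limit \<beta>)
  obtain \<mu> where \<mu>: "\<mu> < \<beta>" "\<xi> < ord_pow omega0 \<mu>"
    using limit.prems less_ord_pow_limit[OF limit.hyps] by blast
  have \<phi>: "\<And>n. n \<ge> 1 \<Longrightarrow> \<phi> \<beta> n < \<beta>" "(SUP n\<in>{1..}. \<phi> \<beta> n) = \<beta>"
    using assms(1) limit by (auto simp: fundamental_sequences_def)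
  then have "bdd_above (\<phi> \<beta> ` {1..})"
    by (intro bdd_aboveI[of _ \<beta>]) (auto intro: less_imp_le)
  then obtain n where n: "n \<ge> 1" "\<mu> < \<phi> \<beta> n"
    using \<mu>(1) \<phi>(2) less_cSUP_iff[of "{1..}" "\<phi> \<beta>" \<mu>] by auto
  have "\<xi> < ord_pow omega0 (\<phi> \<beta> n)"
    using \<mu>(2) ord_pow_omega0_mono[of \<mu> "\<phi> \<beta> n"] n(2) by (meson less_imp_le order_less_le_trans)
  moreover have "\<phi> \<beta> n < omega1"
    using \<phi>(1)[OF n(1)] limit.prems order_less_trans by blast
  ultimately have "accommodates (schreier_family \<phi> (\<phi> \<beta> n)) \<xi>"
    using limit.IH \<phi>(1)[OF n(1)] by blast
  then show ?case
    by (rule accommodates_mono[OF accommodates_le_set[of _ _ n]])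
       (use n(1) schreier_family_limit[OF assms(1) limit.prems(1) limit.hyps] in auto)
qed

section \<open>Weak-star compactness and the Szlenk derivation\<close>

abbreviation weak_star :: "('a::real_normed_vector \<Rightarrow>\<^sub>L real) topology"
  where "weak_star \<equiv> strong_operator_topology"

abbreviation dual_ball :: "('a::real_normed_vector \<Rightarrow>\<^sub>L real) set"
  where "dual_ball \<equiv> cball 0 1"

lemma closedin_weak_star_preimage:
  assumes "closed C"
  shows "closedin weak_star {f. blinfun_apply f x \<in> C}"
  using closedin_continuous_map_preimage[OF strong_operator_topology_continuous_evaluation[of x], of C]
    assms by (simp add: strong_operator_topology_topspace)

lemma dual_ball_iff: "f \<in> dual_ball \<longleftrightarrow> (\<forall>x. \<bar>blinfun_apply f x\<bar> \<le> norm x)"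
proof
  assume "f \<in> dual_ball"
  then have "norm f \<le> 1" by simp
  then show "\<forall>x. \<bar>blinfun_apply f x\<bar> \<le> norm x"
    by (metis abs_norm_cancel mult_left_le_one_le norm_blinfun norm_ge_zero order_trans real_norm_def)
next
  assume "\<forall>x. \<bar>blinfun_apply f x\<bar> \<le> norm x"
  then show "f \<in> dual_ball"
    using norm_blinfun_bound[of 1 f] by simp
qed

lemma closedin_dual_ball:
  "closedin weak_star (dual_ball :: ('a::real_normed_vector \<Rightarrow>\<^sub>L real) set)"
proof -
  have "(dual_ball :: ('a \<Rightarrow>\<^sub>L real) set) = (\<Inter>x. {f. blinfun_apply f x \<in> {- norm x..norm x}})"
    unfolding set_eq_iff dual_ball_iff by (auto simp: abs_le_iff minus_le_iff)
  moreover have "closedin weak_star (\<Inter>x::'a. {f. blinfun_apply f x \<in> {- norm x..norm x}})"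
    by (intro closedin_INT closedin_weak_star_preimage) auto
  ultimately show ?thesis by simp
qed

text \<open>
  The ball is the continuous image of the linear functions in a product of compact intervals.
\<close>

theorem banach_alaoglu:
  "compactin weak_star (dual_ball :: ('a::real_normed_vector \<Rightarrow>\<^sub>L real) set)"
proof -
  define P :: "('a \<Rightarrow> real) set" where "P = (\<Pi>\<^sub>E x\<in>UNIV. {- norm x..norm x})"
  define L :: "('a \<Rightarrow> real) set" where
    "L = {g. (\<forall>x y. g (x + y) = g x + g y) \<and> (\<forall>c x. g (c *\<^sub>R x) = c * g x)}"
  have "compactin (product_topology (\<lambda>_. euclidean) UNIV) P"
    unfolding P_def by (subst compactin_PiE) auto
  then have "compact P"
    by (simp add: euclidean_product_topology)
  moreover have "closed L"
    unfolding L_def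
    by (intro closed_Collect_conj closed_Collect_all closed_Collect_eq continuous_intros
        continuous_on_product_coordinates)
  ultimately have "compact (P \<inter> L)" by blast
  have Blinfun: "blinfun_apply (Blinfun g) = g" if "g \<in> P \<inter> L" for g
  proof (rule bounded_linear_Blinfun_apply, rule bounded_linear_intro)
    show "norm (g x) \<le> norm x * 1" for x
      using that by (auto simp: P_def PiE_iff abs_le_iff minus_le_iff)
  qed (use that in \<open>auto simp: L_def\<close>)
  have "continuous_map (top_of_set (P \<inter> L)) weak_star Blinfun"
    unfolding continuous_on_strong_operator_topo_iff_coordinatewise
  proof
    fix x
    have "continuous_on (P \<inter> L) (\<lambda>g. g x)"
      by (rule continuous_on_subset[OF continuous_on_product_coordinates]) simp
    then have "continuous_on (P \<inter> L) (\<lambda>g. blinfun_apply (Blinfun g) x)"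
      by (rule continuous_on_eq) (simp add: Blinfun)
    then show "continuous_map (top_of_set (P \<inter> L)) euclidean (\<lambda>g. blinfun_apply (Blinfun g) x)"
      by simp
  qed
  then have "compactin weak_star (Blinfun ` (P \<inter> L))"
    using \<open>compact (P \<inter> L)\<close> by (intro image_compactin[of "top_of_set (P \<inter> L)"]) auto
  moreover have "Blinfun ` (P \<inter> L) = (dual_ball :: ('a \<Rightarrow>\<^sub>L real) set)"
  proof (intro equalityI subsetI)
    fix f :: "'a \<Rightarrow>\<^sub>L real" assume "f \<in> Blinfun ` (P \<inter> L)"
    then obtain g where g: "g \<in> P \<inter> L" "f = Blinfun g" by blast
    then show "f \<in> dual_ball"
      unfolding dual_ball_iff g(2) Blinfun[OF g(1)]
      by (auto simp: P_def PiE_iff abs_le_iff minus_le_iff)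
  next
    fix f :: "'a \<Rightarrow>\<^sub>L real" assume "f \<in> dual_ball"
    then have "blinfun_apply f \<in> P \<inter> L"
      unfolding dual_ball_iff
      by (auto simp: P_def L_def PiE_iff abs_le_iff minus_le_iff blinfun.add_right blinfun.scaleR_right)
    then show "f \<in> Blinfun ` (P \<inter> L)"
      by (metis blinfun_apply_inverse image_eqI)
  qed
  ultimately show ?thesis by simp
qed

lemma szlenk_set_0: "szlenk_set 0 K \<epsilon> = K"
  and szlenk_set_suc: "szlenk_set (ord_suc \<beta>) K \<epsilon> = szlenk_derivation \<epsilon> (szlenk_set \<beta> K \<epsilon>)"
  by (simp_all add: szlenk_set_def ord_rec_0 ord_rec_suc)

lemma szlenk_set_limit: "is_limit \<delta> \<Longrightarrow> szlenk_set \<delta> K \<epsilon> = (\<Inter>\<beta>\<in>{..<\<delta>}. szlenk_set \<beta> K \<epsilon>)"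
  by (auto simp: szlenk_set_def ord_rec_limit)

lemma szlenk_set_antimono: "\<beta> \<le> \<gamma> \<Longrightarrow> szlenk_set \<gamma> K \<epsilon> \<subseteq> szlenk_set \<beta> K \<epsilon>"
proof (induction \<gamma> rule: ordinal_induct)
  case zero
  then have "\<beta> = 0" using zero_le_ordinal by (rule antisym)
  then show ?case by simp
next
  case (suc \<gamma>)
  have "szlenk_set (ord_suc \<gamma>) K \<epsilon> \<subseteq> szlenk_set \<gamma> K \<epsilon>"
    by (auto simp: szlenk_set_suc szlenk_derivation_def)
  then show ?case
    using suc less_ord_suc_iff by (metis order_le_less order_refl order_trans)
next
  case (limit \<gamma>)
  show ?case
  proof (cases "\<beta> = \<gamma>")
    case False
    then show ?thesis using limit by (auto simp: szlenk_set_limit)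
  qed simp
qed

lemma closedin_szlenk_derivation:
  assumes "closedin weak_star K"
  shows "closedin weak_star (szlenk_derivation \<epsilon> K)"
proof -
  have "szlenk_derivation \<epsilon> K =
      K - \<Union>{U. openin weak_star U \<and> \<not> diameter (U \<inter> K) > \<epsilon>}"
    unfolding szlenk_derivation_def by auto
  moreover have "openin weak_star (\<Union>{U. openin weak_star U \<and> \<not> diameter (U \<inter> K) > \<epsilon>})"
    by (rule openin_Union) blast
  ultimately show ?thesis using assms by (simp add: closedin_diff)
qed

lemma closedin_szlenk_set:
  assumes "closedin weak_star K"
  shows "closedin weak_star (szlenk_set \<beta> K \<epsilon>)"
proof (induction \<beta> rule: ordinal_induct)
  case (limit \<beta>)
  then have "{..<\<beta>} \<noteq> {}"
    by (metis is_limit_def lessThan_iff empty_iff order_le_less zero_le_ordinal)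
  then show ?case
    using limit by (auto simp: szlenk_set_limit intro!: closedin_INT)
qed (simp_all add: assms szlenk_set_0 szlenk_set_suc closedin_szlenk_derivation)

text \<open>
  Every point of \<open>L\<close> has a weak-star open neighbourhood in which \<open>P\<close> has diameter at most \<open>\<epsilon>\<close>.
  Finitely many of them cover \<open>L\<close>. One functional from each controls the whole of \<open>L\<close> on \<open>y k\<close>
  up to \<open>\<epsilon>\<close>, and these finitely many functionals tend to \<open>0\<close> along the weakly null sequence.
\<close>

lemma eventually_small_off_szlenk_derivation:
  fixes y :: "nat \<Rightarrow> 'a::real_normed_vector"
  assumes L: "compactin weak_star L" "L \<subseteq> P" "szlenk_derivation \<epsilon> P \<inter> L = {}"
    and P: "bounded P" and "\<epsilon> > 0"
    and y: "weakly_null y" "\<forall>\<^sub>F k in sequentially. norm (y k) \<le> 1"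
  shows "\<forall>\<^sub>F k in sequentially. \<forall>f\<in>L. \<bar>blinfun_apply f (y k)\<bar> < 2 * \<epsilon>"
proof -
  let ?\<U> = "{U. openin weak_star U \<and> diameter (U \<inter> P) \<le> \<epsilon>}"
  have "L \<subseteq> \<Union>?\<U>"
  proof
    fix f assume "f \<in> L"
    then have "f \<in> P" "f \<notin> szlenk_derivation \<epsilon> P" using L(2,3) by auto
    then obtain U where "openin weak_star U" "f \<in> U" "\<not> diameter (U \<inter> P) > \<epsilon>"
      unfolding szlenk_derivation_def by blast
    then show "f \<in> \<Union>?\<U>" by auto
  qed
  then obtain \<F> where \<F>: "finite \<F>" "\<F> \<subseteq> ?\<U>" "L \<subseteq> \<Union>\<F>"
    using compactinD[OF L(1), of ?\<U>] by blast
  have "\<forall>\<^sub>F k in sequentially. \<forall>f\<in>U \<inter> L. \<bar>blinfun_apply f (y k)\<bar> < 2 * \<epsilon>" if "U \<in> \<F>" for U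
  proof (cases "U \<inter> L = {}")
    case False
    then obtain g where g: "g \<in> U \<inter> L" by blast
    have "(\<lambda>k. blinfun_apply g (y k)) \<longlonglongrightarrow> 0"
      using y(1) by (simp add: weakly_null_def)
    then have "\<forall>\<^sub>F k in sequentially. \<bar>blinfun_apply g (y k)\<bar> < \<epsilon>"
      using \<open>\<epsilon> > 0\<close> by (auto dest!: tendstoD[of _ _ _ \<epsilon>])
    with y(2) show ?thesis
    proof eventually_elim
      case (elim k)
      show ?case
      proof
        fix f assume f: "f \<in> U \<inter> L"
        have "dist f g \<le> diameter (U \<inter> P)"
          using f g L(2) P by (intro diameter_bounded_bound) (auto intro: bounded_subset)
        then have "norm (f - g) \<le> \<epsilon>"
          using \<F>(2) \<open>U \<in> \<F>\<close> by (auto simp: dist_norm)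
        then have "norm (f - g) * norm (y k) \<le> \<epsilon> * 1"
          using elim by (intro mult_mono) auto
        then have "\<bar>blinfun_apply (f - g) (y k)\<bar> \<le> \<epsilon>"
          using norm_blinfun[of "f - g" "y k"] by simp
        then show "\<bar>blinfun_apply f (y k)\<bar> < 2 * \<epsilon>"
          using elim by (simp add: blinfun.diff_left)
      qed
    qed
  qed simp
  then have "\<forall>\<^sub>F k in sequentially. \<forall>U\<in>\<F>. \<forall>f\<in>U \<inter> L. \<bar>blinfun_apply f (y k)\<bar> < 2 * \<epsilon>"
    using \<F>(1) by (simp add: eventually_ball_finite)
  then show ?thesis
    by eventually_elim (use \<F>(3) in blast)
qed

text \<open>
  The least \<open>\<beta>\<close> for which the derived set misses \<open>K\<close> is not a limit: a decreasing family of
  nonempty weak-star compact sets has nonempty intersection. It is not \<open>0\<close> either, so it is the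
  successor of the wanted \<open>\<zeta>\<close>.
\<close>

lemma szlenk_set_disjoint_suc:
  assumes K: "closedin weak_star K" "K \<inter> dual_ball \<noteq> {}"
    and "szlenk_set \<xi> dual_ball \<epsilon> \<inter> K = {}"
  shows "\<exists>\<zeta><\<xi>. szlenk_set (ord_suc \<zeta>) dual_ball \<epsilon> \<inter> K = {}"
proof -
  let ?P = "\<lambda>\<beta>. szlenk_set \<beta> dual_ball \<epsilon>"
  define \<beta> where "\<beta> = (LEAST \<beta>. ?P \<beta> \<inter> K = {})"
  have \<beta>: "?P \<beta> \<inter> K = {}" "\<beta> \<le> \<xi>"
    unfolding \<beta>_def using assms(3) by (rule LeastI, rule Least_le)
  have less: "?P \<gamma> \<inter> K \<noteq> {}" if "\<gamma> < \<beta>" for \<gamma>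
    using that unfolding \<beta>_def by (rule not_less_Least)
  show ?thesis
  proof (cases \<beta> rule: ordinal_cases)
    case zero
    then show ?thesis using \<beta>(1) K(2) by (auto simp: szlenk_set_0)
  next
    case (suc \<zeta>)
    then show ?thesis using \<beta> less_ord_suc[of \<zeta>] by (auto intro: order_less_le_trans)
  next
    case limit
    let ?\<U> = "(\<lambda>\<gamma>. ?P \<gamma> \<inter> K) ` {..<\<beta>}"
    have "dual_ball \<inter> \<Inter>?\<U> \<noteq> {}"
    proof (rule compactin_fip[THEN iffD1, OF banach_alaoglu, THEN conjunct2, rule_format],
        intro conjI ballI allI impI)
      show "closedin weak_star C" if "C \<in> ?\<U>" for C
        using that K(1) by (auto intro!: closedin_Int closedin_szlenk_set closedin_dual_ball)
      fix \<F> assume "finite \<F> \<and> \<F> \<subseteq> ?\<U>"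
      then obtain G where G: "G \<subseteq> {..<\<beta>}" "finite G" "\<F> = (\<lambda>\<gamma>. ?P \<gamma> \<inter> K) ` G"
        by (meson finite_subset_image)
      show "dual_ball \<inter> \<Inter>\<F> \<noteq> {}"
      proof (cases "G = {}")
        case False
        then have "?P (Max G) \<inter> K \<noteq> {}"
          using G by (intro less) (auto simp: subset_iff)
        moreover have "?P (Max G) \<subseteq> ?P \<gamma>" if "\<gamma> \<in> G" for \<gamma>
          using G(2) that by (intro szlenk_set_antimono) simp
        moreover have "?P (Max G) \<subseteq> dual_ball"
          using szlenk_set_antimono[of 0 "Max G" dual_ball \<epsilon>] by (simp add: szlenk_set_0)
        ultimately show ?thesis unfolding G(3) by blast
      qed (use K(2) G(3) in auto)
    qed
    moreover have "{..<\<beta>} \<noteq> {}"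
      using infinite_lessThan_limit[OF limit] by auto
    then have "\<Inter>?\<U> \<subseteq> ?P \<beta> \<inter> K"
      by (auto simp: szlenk_set_limit[OF limit])
    ultimately show ?thesis using \<beta>(1) by blast
  qed
qed

lemma szlenk_set_ord_pow_empty:
  assumes "szlenk_index TYPE('a::real_normed_vector) \<le> ord_pow omega0 \<alpha>" "\<alpha> < omega1" "\<epsilon> > 0"
  shows "szlenk_set (ord_pow omega0 \<alpha>) (dual_ball :: ('a \<Rightarrow>\<^sub>L real) set) \<epsilon> = {}"
proof -
  let ?P = "\<lambda>\<beta>. szlenk_set \<beta> (dual_ball :: ('a \<Rightarrow>\<^sub>L real) set) \<epsilon>"
  have le: "szlenk_eta (dual_ball :: ('a \<Rightarrow>\<^sub>L real) set) \<epsilon> \<le> ord_pow omega0 \<alpha>"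
    using assms(1,3) by (simp add: szlenk_index_le_iff)
  have ex: "\<exists>\<beta><omega1. ?P \<beta> = {}"
    using le ord_pow_omega0_less_omega1[OF assms(2)] by (auto simp: szlenk_eta_def split: if_splits)
  then have "?P (LEAST \<beta>. \<beta> < omega1 \<and> ?P \<beta> = {}) = {}"
    by (metis (mono_tags, lifting) LeastI_ex)
  then have "?P (szlenk_eta (dual_ball :: ('a \<Rightarrow>\<^sub>L real) set) \<epsilon>) = {}"
    using ex by (simp add: szlenk_eta_def)
  then show ?thesis using szlenk_set_antimono[OF le] by blast
qed

section \<open>Norming functionals\<close>

definition sublinear :: "('a::real_vector \<Rightarrow> real) \<Rightarrow> bool"
  where "sublinear q \<longleftrightarrow> (\<forall>x y. q (x + y) \<le> q x + q y) \<and> (\<forall>c\<ge>0. \<forall>x. q (c *\<^sub>R x) = c * q x)"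

lemma sublinearI:
  assumes "\<And>x y. q (x + y) \<le> q x + q y" and "\<And>c x. c > 0 \<Longrightarrow> q (c *\<^sub>R x) \<le> c * q x" and "q 0 = 0"
  shows "sublinear q"
proof -
  have "q (c *\<^sub>R x) = c * q x" if "c > 0" for c x
  proof (rule antisym)
    have "q (inverse c *\<^sub>R c *\<^sub>R x) \<le> inverse c * q (c *\<^sub>R x)"
      using that by (intro assms(2)) simp
    then show "c * q x \<le> q (c *\<^sub>R x)"
      using that by (simp add: field_simps)
  qed (use assms(2) that in blast)
  then show ?thesis
    unfolding sublinear_def using assms by (auto simp: order_le_less)
qed

lemma sublinear_lower_bound:
  assumes "sublinear q"
  shows "- q (- x) \<le> q x"
proof -
  have "q 0 = 0"
    using assms unfolding sublinear_def by (metis order_refl mult_zero_left scale_zero_left)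
  moreover have "q (x + - x) \<le> q x + q (- x)"
    using assms unfolding sublinear_def by blast
  ultimately show ?thesis by simp
qed

text \<open>
  The witness \<open>x \<mapsto> inf\<^sub>t (p (x + t y) - t p y)\<close>, with \<open>t\<close> ranging over the nonnegative reals, is the
  standard way to lower \<open>p\<close> until it is additive in the direction of \<open>y\<close>.
\<close>

lemma sublinear_shift:
  assumes "sublinear p"
  shows "\<exists>q. sublinear q \<and> (\<forall>x. q x \<le> p x) \<and> q (- y) \<le> - p y"
proof -
  have add: "p (a + b) \<le> p a + p b" and scale: "c \<ge> 0 \<Longrightarrow> p (c *\<^sub>R a) = c * p a" for a b c
    using assms unfolding sublinear_def by blast+
  define h where "h t x = p (x + t *\<^sub>R y) - t * p y" for t x
  define q where "q x = (INF t\<in>{0..}. h t x)" for x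
  have "- p (- x) \<le> h t x" if "t \<ge> 0" for t x
    using add[of "x + t *\<^sub>R y" "- x"] scale[OF that, of y] by (simp add: h_def)
  then have bdd: "bdd_below ((\<lambda>t. h t x) ` {0..})" for x
    by (intro bdd_belowI[of _ "- p (- x)"]) auto
  have le: "q x \<le> h t x" if "t \<ge> 0" for t x
    unfolding q_def using that by (intro cINF_lower bdd) auto
  have ge: "r \<le> q x" if "\<And>t. t \<ge> 0 \<Longrightarrow> r \<le> h t x" for r x
    unfolding q_def using that by (intro cINF_greatest) auto
  have "sublinear q"
  proof (rule sublinearI)
    fix a b
    have "q (a + b) \<le> h s a + h t b" if "s \<ge> 0" "t \<ge> 0" for s t
    proof -
      have "h (s + t) (a + b) \<le> h s a + h t b"
        using add[of "a + s *\<^sub>R y" "b + t *\<^sub>R y"] by (simp add: h_def algebra_simps)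
      then show ?thesis using le[of "s + t" "a + b"] that by simp
    qed
    then have "q (a + b) - h t b \<le> q a" if "t \<ge> 0" for t
      using that by (intro ge) (simp add: algebra_simps)
    then have "q (a + b) - q a \<le> q b"
      by (intro ge) (simp add: algebra_simps)
    then show "q (a + b) \<le> q a + q b" by simp
  next
    fix c :: real and x assume c: "c > 0"
    have "q (c *\<^sub>R x) / c \<le> h t x" if "t \<ge> 0" for t
    proof -
      have "h (c * t) (c *\<^sub>R x) = c * h t x"
        using scale[of c "x + t *\<^sub>R y"] c by (simp add: h_def algebra_simps)
      then show ?thesis
        using le[of "c * t" "c *\<^sub>R x"] that c by (simp add: field_simps)
    qed
    then have "q (c *\<^sub>R x) / c \<le> q x" by (rule ge)
    then show "q (c *\<^sub>R x) \<le> c * q x" using c by (simp add: field_simps)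
  next
    have "h t 0 = 0" if "t \<ge> 0" for t
      using scale[OF that, of y] by (simp add: h_def)
    then show "q 0 = 0"
      using le[of 0 0] ge[of 0 0] by force
  qed
  moreover have "q x \<le> p x" for x
    using le[of 0 x] by (simp add: h_def)
  moreover have "q (- y) \<le> - p y"
    using le[of 1 "- y"] scale[of 0 0] by (simp add: h_def)
  ultimately show ?thesis by blast
qed

text \<open>
  A minimal sublinear functional below \<open>p\<close> is linear: by minimality it is unchanged by
  \<open>sublinear_shift\<close> in every direction, hence odd. The infimum of a chain of sublinear functionals
  is again sublinear, so minimal ones exist by Zorn's lemma.
\<close>

lemma sublinear_dominates_linear:
  assumes "sublinear p"
  shows "\<exists>f. linear f \<and> (\<forall>x. f x \<le> p x)"
proof -
  define A where "A = {q. sublinear q \<and> (\<forall>x. q x \<le> p x)}"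
  define P where "P a u \<longleftrightarrow> (\<forall>x. u x \<le> a x)" for a u :: "'a \<Rightarrow> real"
  have lower: "- p (- x) \<le> q x" if "q \<in> A" for q x
    using that sublinear_lower_bound[of q x] unfolding A_def
    by (metis (mono_tags, lifting) le_imp_neg_le mem_Collect_eq order_trans)
  have "\<exists>m\<in>A. \<forall>a\<in>A. P m a \<longrightarrow> a = m"
  proof (rule predicate_Zorn)
    show "partial_order_on A (relation_of P A)"
      by (rule partial_order_on_relation_ofI) (auto simp: P_def fun_eq_iff intro: order_trans antisym)
    fix C assume C: "C \<in> Chains (relation_of P A)"
    then have CA: "C \<subseteq> A" by (auto simp: Chains_def relation_of_def)
    have chain: "P a b \<or> P b a" if "a \<in> C" "b \<in> C" for a b
      using C that by (auto simp: Chains_def relation_of_def)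
    show "\<exists>u\<in>A. \<forall>a\<in>C. P a u"
    proof (cases "C = {}")
      case True
      then show ?thesis using assms by (auto simp: A_def)
    next
      case False
      define u where "u x = (INF q\<in>C. q x)" for x
      have bdd: "bdd_below ((\<lambda>q. q x) ` C)" for x
        using lower CA by (intro bdd_belowI[of _ "- p (- x)"]) auto
      have le: "u x \<le> q x" if "q \<in> C" for q x
        unfolding u_def using that by (intro cINF_lower bdd) auto
      have ge: "r \<le> u x" if "\<And>q. q \<in> C \<Longrightarrow> r \<le> q x" for r x
        unfolding u_def using that False by (intro cINF_greatest) auto
      have sub: "q (x + y) \<le> q x + q y" "c \<ge> 0 \<Longrightarrow> q (c *\<^sub>R x) = c * q x" if "q \<in> C" for q x y c
        using that CA unfolding A_def sublinear_def by blast+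
      have "sublinear u"
      proof (rule sublinearI)
        fix x y
        have *: "u (x + y) \<le> q1 x + q2 y" if q: "q1 \<in> C" "q2 \<in> C" for q1 q2
        proof -
          obtain q where "q \<in> C" "q x \<le> q1 x" "q y \<le> q2 y"
            using chain[OF q] q unfolding P_def by (metis order_refl)
          then show ?thesis using le[of q "x + y"] sub(1)[of q x y] by linarith
        qed
        have "u (x + y) - q2 y \<le> u x" if "q2 \<in> C" for q2
          using *[OF _ that] by (intro ge) (simp add: algebra_simps)
        then have "u (x + y) - u x \<le> u y"
          by (intro ge) (simp add: algebra_simps)
        then show "u (x + y) \<le> u x + u y" by simp
      next
        fix c :: real and x assume c: "c > 0"
        have "u (c *\<^sub>R x) / c \<le> u x"
        proof (rule ge)
          fix q assume q: "q \<in> C"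
          show "u (c *\<^sub>R x) / c \<le> q x"
            using le[OF q, of "c *\<^sub>R x"] sub(2)[OF q, of c x] c by (simp add: field_simps)
        qed
        then show "u (c *\<^sub>R x) \<le> c * u x" using c by (simp add: field_simps)
      next
        have "q 0 = 0" if "q \<in> C" for q
          using sub(2)[OF that, of 0 0] by simp
        then show "u 0 = 0"
          using False ge[of 0 0] le[of _ 0] by force
      qed
      moreover have "u x \<le> p x" for x
      proof -
        obtain q where "q \<in> C" using False by blast
        then have "u x \<le> q x" "q x \<le> p x" using le CA by (auto simp: A_def)
        then show ?thesis by simp
      qed
      ultimately show ?thesis using le unfolding A_def P_def by blast
    qed
  qed
  then obtain m where m: "sublinear m" "\<And>x. m x \<le> p x"
    and "\<And>q. q \<in> A \<Longrightarrow> P m q \<Longrightarrow> q = m"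
    unfolding A_def by blast
  then have minimal: "q = m" if "sublinear q" "\<And>x. q x \<le> m x" for q
    using that unfolding A_def P_def by (blast intro: order_trans)
  have neg: "m (- y) = - m y" for y
  proof (rule antisym)
    show "m (- y) \<le> - m y"
      using sublinear_shift[OF m(1), of y] minimal by metis
    show "- m y \<le> m (- y)"
      using sublinear_lower_bound[OF m(1), of "- y"] by simp
  qed
  have add: "m (x + y) \<le> m x + m y" and scale: "c \<ge> 0 \<Longrightarrow> m (c *\<^sub>R x) = c * m x" for x y c
    using m(1) unfolding sublinear_def by blast+
  have "linear m"
  proof
    show "m (x + y) = m x + m y" for x y
      using add[of x y] add[of "x + y" "- y"] neg[of y] by simp
    show "m (c *\<^sub>R x) = c *\<^sub>R m x" for c x
    proof (cases "c \<ge> 0")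
      case False
      then have "m ((- c) *\<^sub>R x) = - c * m x" by (intro scale) simp
      then show ?thesis using neg[of "c *\<^sub>R x"] by simp
    qed (simp add: scale)
  qed
  then show ?thesis using m(2) by blast
qed

text \<open>
  Shifting the norm in the direction of \<open>z\<close> gives a sublinear functional that is at most
  \<open>- norm z\<close> at \<open>- z\<close>, so every linear functional below it norms \<open>z\<close>.
\<close>

lemma norming_functional:
  fixes z :: "'a::real_normed_vector"
  obtains f :: "'a \<Rightarrow>\<^sub>L real" where "f \<in> dual_ball" "norm z \<le> blinfun_apply f z"
proof -
  have "sublinear (norm :: 'a \<Rightarrow> real)"
    by (auto simp: sublinear_def norm_triangle_ineq)
  then obtain p where p: "sublinear p" "\<And>x::'a. p x \<le> norm x" "p (- z) \<le> - norm z"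
    using sublinear_shift[of norm z] by blast
  obtain f where f: "linear f" "\<And>x. f x \<le> p x"
    using sublinear_dominates_linear[OF p(1)] by blast
  have neg: "f (- x) = - f x" for x by (rule linear_neg[OF f(1)])
  have bound: "\<bar>f x\<bar> \<le> norm x" for x
    using f(2)[of x] p(2)[of x] f(2)[of "- x"] p(2)[of "- x"] by (simp add: neg)
  have "bounded_linear f"
    using f(1) bound by (intro bounded_linear_intro[of f 1]) (auto simp: linear_add linear_cmul)
  then have F: "blinfun_apply (Blinfun f) = f" by (rule bounded_linear_Blinfun_apply)
  show ?thesis
  proof
    show "Blinfun f \<in> dual_ball"
      unfolding dual_ball_iff F using bound by blast
    show "norm z \<le> blinfun_apply (Blinfun f) z"
      using f(2)[of "- z"] p(3) by (simp add: F neg)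
  qed
qed

section \<open>Choosing the branch\<close>

text \<open>
  The residual of \<open>\<S>\<close> after all elements of \<open>D\<close> have been played.
\<close>

definition continuations :: "nat set \<Rightarrow> nat set set \<Rightarrow> nat set set"
  where "continuations D \<S> = {E. (\<forall>d\<in>D. \<forall>i\<in>E. d < i) \<and> D \<union> E \<in> \<S>}"

definition level_set :: "real \<Rightarrow> nat set \<Rightarrow> (nat \<Rightarrow> 'a::real_normed_vector) \<Rightarrow> ('a \<Rightarrow>\<^sub>L real) set"
  where "level_set c A y = {f. \<forall>i\<in>A. c \<le> \<bar>blinfun_apply f (y i)\<bar>}"

text \<open>
  The invariant kept for a set \<open>K\<close> of functionals and the family \<open>F\<close> of admissible continuations:
  \<open>F\<close> can answer every descent from the Szlenk rank of \<open>K\<close>.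
\<close>

definition controlled :: "real \<Rightarrow> ('a::real_normed_vector \<Rightarrow>\<^sub>L real) set \<Rightarrow> nat set set \<Rightarrow> bool"
  where "controlled \<epsilon> K F \<longleftrightarrow> K \<inter> dual_ball = {} \<or>
    (\<exists>\<xi>. szlenk_set (ord_suc \<xi>) dual_ball \<epsilon> \<inter> K = {} \<and> accommodates F \<xi>)"

lemma closedin_level_set: "closedin weak_star (level_set c A y)"
proof (cases "A = {}")
  case True
  then show ?thesis
    using closedin_topspace[of weak_star] by (simp add: level_set_def strong_operator_topology_topspace)
next
  case False
  have "level_set c A y = (\<Inter>i\<in>A. {f. blinfun_apply f (y i) \<in> {r. c \<le> \<bar>r\<bar>}})"
    unfolding level_set_def by auto
  also have "closedin weak_star \<dots>"
    by (intro closedin_INT closedin_weak_star_preimage closed_Collect_le continuous_intros False)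
  finally show ?thesis .
qed

lemma controlled_mono: "controlled \<epsilon> K F \<Longrightarrow> F \<subseteq> G \<Longrightarrow> controlled \<epsilon> K G"
  unfolding controlled_def using accommodates_mono[OF _ _ order_refl] by blast

text \<open>
  First \<open>m\<close> is chosen with the strategy for the current rank of \<open>K\<close>. Once \<open>k\<close> is large, no functional
  of maximal rank in \<open>K\<close> is large at \<open>y k\<close>, so the rank of the remaining set has dropped, which is
  the move of the opponent.
\<close>

lemma controlled_step:
  fixes K :: "('a::real_normed_vector \<Rightarrow>\<^sub>L real) set"
  assumes "controlled \<epsilon> K F" "closedin weak_star K" "\<epsilon> > 0"
  shows "\<forall>\<^sub>F m in sequentially. \<forall>y. weakly_null y \<and> (\<forall>\<^sub>F k in sequentially. norm (y k) \<le> 1) \<longrightarrow>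
    (\<forall>\<^sub>F k in sequentially.
      controlled \<epsilon> (K \<inter> {f. 2 * \<epsilon> \<le> \<bar>blinfun_apply f (y k)\<bar>}) (residual m F))"
proof (cases "K \<inter> dual_ball = {}")
  case True
  then have "controlled \<epsilon> (K \<inter> B) G" for B G
    unfolding controlled_def by blast
  then show ?thesis by simp
next
  case False
  then obtain \<xi> where \<xi>: "szlenk_set (ord_suc \<xi>) dual_ball \<epsilon> \<inter> K = {}" "accommodates F \<xi>"
    using assms(1) unfolding controlled_def by blast
  from \<xi>(2) have "\<forall>\<^sub>F m in sequentially. \<forall>\<zeta><\<xi>. accommodates (residual m F) \<zeta>"
    unfolding eventually_sequentially by cases
  then show ?thesis
  proof eventually_elim
    case (elim m)
    show ?case
    proof (intro allI impI)
      fix y :: "nat \<Rightarrow> 'a"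
      assume y: "weakly_null y \<and> (\<forall>\<^sub>F k in sequentially. norm (y k) \<le> 1)"
      let ?P = "szlenk_set \<xi> dual_ball \<epsilon> :: ('a \<Rightarrow>\<^sub>L real) set"
      have P: "?P \<subseteq> dual_ball"
        using szlenk_set_antimono[of 0 \<xi> dual_ball \<epsilon>] by (simp add: szlenk_set_0)
      have "compactin weak_star ((K \<inter> ?P) \<inter> dual_ball)"
        using assms(2) banach_alaoglu
        by (intro closed_Int_compactin closedin_Int closedin_szlenk_set closedin_dual_ball)
      moreover have "(K \<inter> ?P) \<inter> dual_ball = K \<inter> ?P" using P by blast
      ultimately have "compactin weak_star (K \<inter> ?P)" by simp
      then have "\<forall>\<^sub>F k in sequentially. \<forall>f\<in>K \<inter> ?P. \<bar>blinfun_apply f (y k)\<bar> < 2 * \<epsilon>"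
        using \<xi>(1) y P assms(3) bounded_subset[OF bounded_cball P]
        by (intro eventually_small_off_szlenk_derivation[where P = ?P])
           (auto simp: szlenk_set_suc)
      then show "\<forall>\<^sub>F k in sequentially.
          controlled \<epsilon> (K \<inter> {f. 2 * \<epsilon> \<le> \<bar>blinfun_apply f (y k)\<bar>}) (residual m F)"
      proof eventually_elim
        case (elim k)
        let ?K = "K \<inter> {f. 2 * \<epsilon> \<le> \<bar>blinfun_apply f (y k)\<bar>}"
        have "closedin weak_star ?K"
          using assms(2) closedin_level_set[of "2 * \<epsilon>" "{k}" y]
          by (intro closedin_Int) (simp_all add: level_set_def)
        moreover have "?P \<inter> ?K = {}"
          using elim by (auto simp: not_le[symmetric])
        ultimately show ?case
          using szlenk_set_disjoint_suc[of ?K \<xi> \<epsilon>] \<open>\<forall>\<zeta><\<xi>. accommodates (residual m F) \<zeta>\<close>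
          unfolding controlled_def by blast
      qed
    qed
  qed
qed

lemma residual_continuations: "residual m (continuations D \<S>) \<subseteq> continuations (insert m D) \<S>"
  by (auto simp: residual_def continuations_def)

definition branch_vec :: "(nat list \<Rightarrow> 'a) \<Rightarrow> (nat \<Rightarrow> nat) \<Rightarrow> nat \<Rightarrow> 'a"
  where "branch_vec x \<kappa> i = x (map \<kappa> [1..<2 * i + 1])"

text \<open>
  The first \<open>n\<close> vectors of the branch \<open>\<kappa>\<close> keep all levels under control. Level \<open>j\<close> looks at the
  threshold \<open>2\<^sup>-\<^sup>j\<close> and at coordinates from \<open>j\<close> on; the Szlenk parameter is half the threshold, as
  required by \<open>eventually_small_off_szlenk_derivation\<close>. For \<open>j > n\<close> only \<open>A = {}\<close> is considered.
\<close>

definition branch_controlled ::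
    "nat set set \<Rightarrow> (nat list \<Rightarrow> 'a::real_normed_vector) \<Rightarrow> nat \<Rightarrow> (nat \<Rightarrow> nat) \<Rightarrow> bool"
  where "branch_controlled \<S> x n \<kappa> \<longleftrightarrow> map \<kappa> [1..<2 * n + 1] \<in> T_fin (2 * n) \<and>
    (\<forall>j\<ge>1. \<forall>A\<subseteq>{j..n}. controlled ((1/2) ^ Suc j) (level_set ((1/2) ^ j) A (branch_vec x \<kappa>))
      (continuations ((\<lambda>i. \<kappa> (2 * i - 1)) ` A) \<S>))"

lemma T_fin_snoc:
  assumes "t \<in> T_fin l" "1 \<le> m" "\<forall>i\<in>set t. i < m"
  shows "t @ [m] \<in> T_fin (Suc l)"
  using assms by (auto simp: T_fin_def sorted_wrt_append)

text \<open>
  Only the finitely many pairs \<open>(j, A)\<close> with \<open>j \<le> n + 1\<close> and \<open>A \<subseteq> {j..n}\<close> can acquire the new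
  coordinate \<open>n + 1\<close>. So finitely many applications of \<open>controlled_step\<close> hold simultaneously
  for all large \<open>m = k\<^sub>2\<^sub>n\<^sub>+\<^sub>1\<close> and, after that, for all large \<open>k\<^sub>2\<^sub>n\<^sub>+\<^sub>2\<close>.
\<close>

lemma branch_controlled_step:
  fixes x :: "nat list \<Rightarrow> 'a::real_normed_vector"
  assumes x: "normalized_tree x" "weakly_null_tree x" and \<kappa>: "branch_controlled \<S> x n \<kappa>"
  shows "\<exists>\<kappa>'. branch_controlled \<S> x (Suc n) \<kappa>' \<and> (\<forall>i\<le>2 * n. \<kappa>' i = \<kappa> i)"
proof -
  define t where "t = map \<kappa> [1..<2 * n + 1]"
  define K where "K j A = level_set ((1/2) ^ j) A (branch_vec x \<kappa>)" for j :: nat and A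
  define F where "F A = continuations ((\<lambda>i. \<kappa> (2 * i - 1)) ` A) \<S>" for A
  define I where "I = (SIGMA j:{1..Suc n}. Pow {j..n})"
  define next_ok where "next_ok y m k \<longleftrightarrow>
    (\<forall>(j, A)\<in>I. controlled ((1/2) ^ Suc j) (K j A \<inter> {f. (1/2) ^ j \<le> \<bar>blinfun_apply f (y k)\<bar>})
      (residual m (F A)))" for y :: "nat \<Rightarrow> 'a" and m k
  have t: "t \<in> T_fin (2 * n)"
    using \<kappa> unfolding branch_controlled_def t_def by blast
  have ctrl: "controlled ((1/2) ^ Suc j) (K j A) (F A)" if "j \<ge> 1" "A \<subseteq> {j..n}" for j A
    using \<kappa> that unfolding branch_controlled_def K_def F_def by blast
  have fin: "finite I" unfolding I_def by auto
  have "\<forall>\<^sub>F m in sequentially. \<forall>(j, A)\<in>I.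
      \<forall>y. weakly_null y \<and> (\<forall>\<^sub>F k in sequentially. norm (y k) \<le> 1) \<longrightarrow>
      (\<forall>\<^sub>F k in sequentially. controlled ((1/2) ^ Suc j)
        (K j A \<inter> {f. 2 * (1/2) ^ Suc j \<le> \<bar>blinfun_apply f (y k)\<bar>}) (residual m (F A)))"
    using fin
  proof (rule eventually_ball_finite, safe)
    fix j A assume "(j, A) \<in> I"
    then show "\<forall>\<^sub>F m in sequentially.
      \<forall>y. weakly_null y \<and> (\<forall>\<^sub>F k in sequentially. norm (y k) \<le> 1) \<longrightarrow>
      (\<forall>\<^sub>F k in sequentially. controlled ((1/2) ^ Suc j)
        (K j A \<inter> {f. 2 * (1/2) ^ Suc j \<le> \<bar>blinfun_apply f (y k)\<bar>}) (residual m (F A)))"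
      by (intro controlled_step ctrl) (auto simp: I_def K_def closedin_level_set)
  qed
  moreover have "\<forall>\<^sub>F m in sequentially. \<forall>i\<in>set t. i < m"
    by (intro eventually_ball_finite ballI eventually_gt_at_top) simp
  moreover have "\<forall>\<^sub>F m in sequentially. (1::nat) \<le> m"
    by (rule eventually_ge_at_top)
  ultimately have "\<forall>\<^sub>F m in sequentially. (\<forall>y. weakly_null y \<and>
      (\<forall>\<^sub>F k in sequentially. norm (y k) \<le> 1) \<longrightarrow> (\<forall>\<^sub>F k in sequentially. next_ok y m k)) \<and>
      (\<forall>i\<in>set t. i < m) \<and> 1 \<le> m"
  proof eventually_elim
    case (elim m)
    have "\<forall>\<^sub>F k in sequentially. next_ok y m k"
      if "weakly_null y" "\<forall>\<^sub>F k in sequentially. norm (y k) \<le> 1" for y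
      unfolding next_ok_def
      by (rule eventually_ball_finite[OF fin]) (use elim(1) that in auto)
    with elim show ?case by blast
  qed
  then obtain m where m: "\<And>y. weakly_null y \<Longrightarrow> \<forall>\<^sub>F k in sequentially. norm (y k) \<le> 1 \<Longrightarrow>
      \<forall>\<^sub>F k in sequentially. next_ok y m k" "\<forall>i\<in>set t. i < m" "1 \<le> m"
    using eventually_happens'[OF sequentially_bot] by blast
  have tm: "t @ [m] \<in> T_fin (Suc (2 * n))"
    by (rule T_fin_snoc[OF t m(3,2)])
  have tmk: "t @ [m, k] \<in> T_fin (2 * Suc n)" if "m < k" for k
    using T_fin_snoc[OF tm, of k] m(2,3) that by force
  define y where "y = (\<lambda>k. x (t @ [m, k]))"
  have "weakly_null y"
    using x(2)[unfolded weakly_null_tree_def, rule_format, of "Suc n" "t @ [m]"] tm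
    by (simp add: y_def)
  moreover have "\<forall>\<^sub>F k in sequentially. norm (y k) \<le> 1"
    using eventually_gt_at_top[of m]
  proof eventually_elim
    case (elim k)
    then show ?case
      using x(1)[unfolded normalized_tree_def, rule_format, of "Suc n"] tmk[OF elim]
      by (simp add: y_def)
  qed
  ultimately have "\<forall>\<^sub>F k in sequentially. next_ok y m k \<and> m < k"
    by (intro eventually_conj m(1) eventually_gt_at_top)
  then obtain k where k: "next_ok y m k" "m < k"
    using eventually_happens'[OF sequentially_bot] by blast
  define \<kappa>' where "\<kappa>' = \<kappa>(Suc (2 * n) := m, 2 * Suc n := k)"
  have \<kappa>'_t: "map \<kappa>' [1..<2 * Suc n + 1] = t @ [m, k]"
    by (simp add: \<kappa>'_def t_def)
  have \<kappa>'_old: "\<kappa>' i = \<kappa> i" if "i \<le> 2 * n" for i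
    using that by (simp add: \<kappa>'_def)
  have vec_old: "branch_vec x \<kappa>' i = branch_vec x \<kappa> i" if "i \<le> n" for i
    unfolding branch_vec_def using that
    by (intro arg_cong[where f = x] map_cong \<kappa>'_old) auto
  have vec_new: "branch_vec x \<kappa>' (Suc n) = y k"
    unfolding branch_vec_def \<kappa>'_t y_def ..
  have idx_old: "(\<lambda>i. \<kappa>' (2 * i - 1)) ` A = (\<lambda>i. \<kappa> (2 * i - 1)) ` A" if "A \<subseteq> {j..n}" for A j
  proof (intro image_cong \<kappa>'_old refl)
    show "2 * i - 1 \<le> 2 * n" if "i \<in> A" for i
      using that \<open>A \<subseteq> {j..n}\<close> by force
  qed
  have K_old: "level_set c A (branch_vec x \<kappa>') = level_set c A (branch_vec x \<kappa>)"
    if "A \<subseteq> {j..n}" for A c j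
    using that vec_old unfolding level_set_def by (auto simp: subset_iff)
  have "controlled ((1/2) ^ Suc j) (level_set ((1/2) ^ j) A (branch_vec x \<kappa>'))
      (continuations ((\<lambda>i. \<kappa>' (2 * i - 1)) ` A) \<S>)" if j: "j \<ge> 1" and A: "A \<subseteq> {j..Suc n}" for j A
  proof (cases "Suc n \<in> A")
    case False
    then have "A \<subseteq> {j..n}" using A by (auto simp: subset_iff le_Suc_eq)
    then show ?thesis
      using ctrl[OF j] idx_old K_old unfolding K_def F_def by metis
  next
    case True
    define A0 where "A0 = A - {Suc n}"
    have A0: "A0 \<subseteq> {j..n}" "A = insert (Suc n) A0" and "j \<le> Suc n"
      using A True by (auto simp: A0_def subset_iff le_Suc_eq)
    then have "(j, A0) \<in> I" using j by (auto simp: I_def)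
    then have "controlled ((1/2) ^ Suc j) (K j A0 \<inter> {f. (1/2) ^ j \<le> \<bar>blinfun_apply f (y k)\<bar>})
        (residual m (F A0))"
      using k(1) unfolding next_ok_def by blast
    moreover have "K j A0 \<inter> {f. (1/2) ^ j \<le> \<bar>blinfun_apply f (y k)\<bar>} =
        level_set ((1/2) ^ j) A (branch_vec x \<kappa>')"
      using K_old[OF A0(1)] vec_new unfolding K_def A0(2) by (auto simp: level_set_def)
    moreover have "\<kappa>' (2 * Suc n - 1) = m"
      by (simp add: \<kappa>'_def)
    then have "residual m (F A0) \<subseteq> continuations ((\<lambda>i. \<kappa>' (2 * i - 1)) ` A) \<S>"
      using residual_continuations unfolding F_def A0(2) image_insert idx_old[OF A0(1)] by metis
    ultimately show ?thesis by (metis controlled_mono)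
  qed
  then have "branch_controlled \<S> x (Suc n) \<kappa>'"
    unfolding branch_controlled_def \<kappa>'_t using tmk[OF k(2)] by blast
  moreover have "\<forall>i\<le>2 * n. \<kappa>' i = \<kappa> i" using \<kappa>'_old by blast
  ultimately show ?thesis by blast
qed

lemma controlled_branch:
  fixes x :: "nat list \<Rightarrow> 'a::real_normed_vector"
  assumes x: "normalized_tree x" "weakly_null_tree x"
    and start: "\<And>\<epsilon>. \<epsilon> > 0 \<Longrightarrow> controlled \<epsilon> (UNIV :: ('a \<Rightarrow>\<^sub>L real) set) \<S>"
  shows "\<exists>\<kappa>. \<forall>n. branch_controlled \<S> x n \<kappa>"
proof -
  have "\<exists>s. \<forall>n. branch_controlled \<S> x n (s n) \<and> (\<forall>i\<le>2 * n. s (Suc n) i = s n i)"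
  proof (rule dependent_nat_choice)
    show "\<exists>\<kappa>. branch_controlled \<S> x 0 \<kappa>"
      using start by (auto simp: branch_controlled_def T_fin_def level_set_def continuations_def)
  qed (use branch_controlled_step[OF x] in blast)
  then obtain s where s: "\<And>n. branch_controlled \<S> x n (s n)" "\<And>n i. i \<le> 2 * n \<Longrightarrow> s (Suc n) i = s n i"
    by blast
  have s_add: "s (n + d) i = s n i" if "i \<le> 2 * n" for n d i
    by (induction d) (use that s(2) in auto)
  define \<kappa> where "\<kappa> i = s i i" for i
  have \<kappa>: "\<kappa> i = s n i" if "i \<le> 2 * n" for n i
    using s_add[of i n i] s_add[of i i n] that by (simp add: \<kappa>_def add.commute)
  have "branch_controlled \<S> x n \<kappa>" for n
  proof -
    have map: "map \<kappa> [1..<2 * i + 1] = map (s n) [1..<2 * i + 1]" if "i \<le> n" for i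
      using that by (intro map_cong) (auto simp: \<kappa>)
    have "branch_vec x \<kappa> i = branch_vec x (s n) i" if "i \<le> n" for i
      unfolding branch_vec_def map[OF that] ..
    then have "level_set c A (branch_vec x \<kappa>) = level_set c A (branch_vec x (s n))"
      if "A \<subseteq> {j..n}" for c A j
      using that by (auto simp: level_set_def subset_iff)
    moreover have "(\<lambda>i. \<kappa> (2 * i - 1)) ` A = (\<lambda>i. s n (2 * i - 1)) ` A" if "A \<subseteq> {j..n}" for A j
    proof (intro image_cong \<kappa> refl)
      show "2 * i - 1 \<le> 2 * n" if "i \<in> A" for i
        using that \<open>A \<subseteq> {j..n}\<close> by force
    qed
    ultimately have "\<forall>j\<ge>1. \<forall>A\<subseteq>{j..n}. controlled ((1/2) ^ Suc j) (level_set ((1/2) ^ j) A (branch_vec x \<kappa>))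
      (continuations ((\<lambda>i. \<kappa> (2 * i - 1)) ` A) \<S>)"
      using s(1)[of n] unfolding branch_controlled_def by simp
    then show ?thesis
      using s(1)[of n] unfolding branch_controlled_def map[OF order_refl] by blast
  qed
  then show ?thesis by blast
qed

text \<open>
  The functional \<open>f\<close> shows that the level set of \<open>A\<close> meets the ball, so the second alternative in
  \<open>controlled\<close> holds, and a family that accommodates some ordinal contains the empty set.
\<close>

lemma branch_controlledD:
  assumes "\<And>n. branch_controlled \<S> x n \<kappa>" "1 \<le> j" "finite A" "A \<subseteq> {j..}"
    and "f \<in> dual_ball" "\<And>i. i \<in> A \<Longrightarrow> (1/2) ^ j \<le> \<bar>blinfun_apply f (branch_vec x \<kappa> i)\<bar>"
  shows "(\<lambda>i. \<kappa> (2 * i - 1)) ` A \<in> \<S>"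
proof -
  obtain n where "A \<subseteq> {..n}" using assms(3) finite_nat_iff_bounded_le by blast
  then have "A \<subseteq> {j..n}" using assms(4) by auto
  then have "controlled ((1/2) ^ Suc j) (level_set ((1/2) ^ j) A (branch_vec x \<kappa>))
      (continuations ((\<lambda>i. \<kappa> (2 * i - 1)) ` A) \<S>)"
    using assms(1)[of n] assms(2) unfolding branch_controlled_def by blast
  moreover have "f \<in> level_set ((1/2) ^ j) A (branch_vec x \<kappa>) \<inter> dual_ball"
    using assms(5,6) by (auto simp: level_set_def)
  ultimately obtain \<xi> where "accommodates (continuations ((\<lambda>i. \<kappa> (2 * i - 1)) ` A) \<S>) \<xi>"
    unfolding controlled_def by blast
  then have "{} \<in> continuations ((\<lambda>i. \<kappa> (2 * i - 1)) ` A) \<S>" by cases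
  then show ?thesis by (simp add: continuations_def)
qed

lemma controlled_UNIV:
  assumes "szlenk_index TYPE('a::real_normed_vector) \<le> ord_pow omega0 \<alpha>" "\<alpha> < omega1" "\<epsilon> > 0"
    and "\<And>\<xi>. \<xi> < ord_pow omega0 \<alpha> \<Longrightarrow> accommodates \<S> \<xi>"
  shows "controlled \<epsilon> (UNIV :: ('a \<Rightarrow>\<^sub>L real) set) \<S>"
proof -
  have "closedin weak_star (UNIV :: ('a \<Rightarrow>\<^sub>L real) set)"
    using closedin_topspace[of weak_star] by (simp add: strong_operator_topology_topspace)
  moreover have "(UNIV :: ('a \<Rightarrow>\<^sub>L real) set) \<inter> dual_ball \<noteq> {}"
    by (metis Int_UNIV_left centre_in_cball empty_iff zero_le_one)
  ultimately show ?thesis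
    using szlenk_set_disjoint_suc[of UNIV "ord_pow omega0 \<alpha>" \<epsilon>] szlenk_set_ord_pow_empty[OF assms(1-3)]
      assms(4) unfolding controlled_def by fastforce
qed

section \<open>The norm estimate\<close>

lemma sum_weights_le: "(\<Sum>j=1..J. real j * (1/2) ^ j) \<le> 2"
proof -
  have "(\<Sum>j=1..J. real j * (1/2) ^ j) = 2 - (real J + 2) * (1/2) ^ J"
    by (induction J) (auto simp: field_simps)
  then show ?thesis by simp
qed

text \<open>
  One summand suffices: if \<open>i\<close> is the least exponent with \<open>2\<^sup>-\<^sup>i \<le> w\<close>, then \<open>w < 2 \<cdot> 2\<^sup>-\<^sup>i\<close>; for
  \<open>w = 1\<close>, where that exponent is \<open>0\<close>, the summand for \<open>i = 1\<close> equals \<open>1\<close>.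
\<close>

lemma dyadic_bound:
  assumes "0 \<le> w" "w \<le> 1" "w \<noteq> 0 \<Longrightarrow> (1/2) ^ J \<le> w" "1 \<le> J"
  shows "w \<le> (\<Sum>j=1..J. if (1/2) ^ j \<le> w then 2 * (1/2) ^ j else (0::real))"
proof (cases "w = 0")
  case False
  define j where "j = (LEAST j. (1/2) ^ j \<le> w)"
  have j: "(1/2) ^ j \<le> w" "j \<le> J"
    unfolding j_def using assms(3)[OF False] by (auto intro: LeastI Least_le)
  have "\<exists>i\<in>{1..J}. (1/2) ^ i \<le> w \<and> w \<le> 2 * (1/2) ^ i"
  proof (cases j)
    case 0
    then show ?thesis using j assms by (intro bexI[of _ 1]) auto
  next
    case (Suc i)
    then have "\<not> (1/2) ^ i \<le> w"
      unfolding j_def by (intro not_less_Least) simp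
    then show ?thesis using j Suc by (intro bexI[of _ j]) auto
  qed
  then obtain i where i: "i \<in> {1..J}" "(1/2) ^ i \<le> w" "w \<le> 2 * (1/2) ^ i" by blast
  have "w \<le> (if (1/2) ^ i \<le> w then 2 * (1/2) ^ i else 0)" using i by simp
  also have "\<dots> \<le> (\<Sum>j=1..J. if (1/2) ^ j \<le> w then 2 * (1/2) ^ j else 0)"
    using i(1) by (intro member_le_sum) auto
  finally show ?thesis .
qed (simp add: sum_nonneg)

lemma c00_support:
  assumes "a \<in> c00"
  shows "finite {n. a n \<noteq> 0}" "{n. a n \<noteq> 0} \<subseteq> {1..}"
proof -
  have "n \<noteq> 0" if "a n \<noteq> 0" for n using assms that unfolding c00_def by (metis (mono_tags) mem_Collect_eq)
  then show "{n. a n \<noteq> 0} \<subseteq> {1..}" by (auto simp: Suc_le_eq)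
qed (use assms in \<open>simp add: c00_def\<close>)

text \<open>
  With \<open>f\<close> norming the combination, each \<open>\<bar>f (y n)\<bar>\<close> is replaced by a dyadic sum and the order of
  summation is exchanged. On level \<open>j\<close> the at most \<open>j - 1\<close> indices below \<open>j\<close> are estimated one by one and
  the others together.
\<close>

lemma norm_lin_comb_le:
  fixes y :: "nat \<Rightarrow> 'a::real_normed_vector"
  assumes a: "a \<in> c00" and y: "\<And>n. 1 \<le> n \<Longrightarrow> norm (y n) \<le> 1"
    and levels: "\<And>f j A. f \<in> dual_ball \<Longrightarrow> 1 \<le> j \<Longrightarrow> finite A \<Longrightarrow> A \<subseteq> {j..} \<Longrightarrow>
      (\<And>i. i \<in> A \<Longrightarrow> (1/2) ^ j \<le> \<bar>blinfun_apply f (y i)\<bar>) \<Longrightarrow> (\<Sum>i\<in>A. \<bar>a i\<bar>) \<le> M"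
    and single: "\<And>n. 1 \<le> n \<Longrightarrow> \<bar>a n\<bar> \<le> M"
  shows "norm (lin_comb a y) \<le> 4 * M"
proof -
  have M: "0 \<le> M" using single[of 1] abs_ge_zero[of "a 1"] by linarith
  define s where "s = {n. a n \<noteq> 0}"
  have fin: "finite s" and s: "s \<subseteq> {1..}"
    unfolding s_def by (rule c00_support[OF a])+
  obtain f where f: "f \<in> dual_ball" "norm (lin_comb a y) \<le> blinfun_apply f (lin_comb a y)"
    by (rule norming_functional)
  define w where "w n = \<bar>blinfun_apply f (y n)\<bar>" for n
  have w: "0 \<le> w n" "w n \<le> 1" if "n \<in> s" for n
  proof -
    have "w n \<le> norm (y n)" using f(1) unfolding w_def dual_ball_iff by blast
    then show "w n \<le> 1" using y[of n] s that by auto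
  qed (simp add: w_def)
  have "\<forall>\<^sub>F J in sequentially. \<forall>n\<in>s. w n \<noteq> 0 \<longrightarrow> (1/2) ^ J \<le> w n"
    using fin
  proof (rule eventually_ball_finite, intro ballI)
    fix n assume n: "n \<in> s"
    show "\<forall>\<^sub>F J in sequentially. w n \<noteq> 0 \<longrightarrow> (1/2) ^ J \<le> w n"
    proof (cases "w n = 0")
      case False
      have "(\<lambda>J. (1/2::real) ^ J) \<longlonglongrightarrow> 0" by (rule LIMSEQ_power_zero) simp
      then have "\<forall>\<^sub>F J in sequentially. (1/2) ^ J < w n"
        using False w(1)[OF n] by (intro order_tendstoD(2)) auto
      then show ?thesis by eventually_elim simp
    qed simp
  qed
  then have "\<forall>\<^sub>F J in sequentially. (\<forall>n\<in>s. w n \<noteq> 0 \<longrightarrow> (1/2) ^ J \<le> w n) \<and> 1 \<le> J"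
    by (intro eventually_conj eventually_ge_at_top)
  then obtain J where J: "\<And>n. n \<in> s \<Longrightarrow> w n \<noteq> 0 \<Longrightarrow> (1/2) ^ J \<le> w n" "1 \<le> J"
    using eventually_happens'[OF sequentially_bot] by blast
  have level_sum: "(\<Sum>n\<in>{n\<in>s. (1/2) ^ j \<le> w n}. \<bar>a n\<bar>) \<le> real j * M" if j: "1 \<le> j" for j
  proof -
    let ?B = "{n\<in>s. (1/2) ^ j \<le> w n}"
    have "(\<Sum>n\<in>?B. \<bar>a n\<bar>) = (\<Sum>n\<in>?B \<inter> {..<j}. \<bar>a n\<bar>) + (\<Sum>n\<in>?B \<inter> {j..}. \<bar>a n\<bar>)"
      using fin by (subst sum.union_disjoint[symmetric]) (auto intro!: sum.cong)
    moreover have "(\<Sum>n\<in>?B \<inter> {..<j}. \<bar>a n\<bar>) \<le> real (j - 1) * M"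
    proof -
      have "(\<Sum>n\<in>?B \<inter> {..<j}. \<bar>a n\<bar>) \<le> (\<Sum>n\<in>{1..<j}. \<bar>a n\<bar>)"
        using s by (intro sum_mono2) auto
      also have "\<dots> \<le> (\<Sum>n\<in>{1..<j}. M)"
        by (intro sum_mono single) simp
      finally show ?thesis by simp
    qed
    moreover have "(\<Sum>n\<in>?B \<inter> {j..}. \<bar>a n\<bar>) \<le> M"
      by (rule levels[OF f(1) j]) (use fin in \<open>auto simp: w_def\<close>)
    ultimately show ?thesis using j by (simp add: of_nat_diff algebra_simps)
  qed
  have "norm (lin_comb a y) \<le> (\<Sum>n\<in>s. a n * blinfun_apply f (y n))"
    using f(2) by (simp add: lin_comb_def s_def blinfun.sum_right blinfun.scaleR_right)
  also have "\<dots> \<le> (\<Sum>n\<in>s. \<bar>a n\<bar> * w n)"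
    unfolding w_def by (intro sum_mono) (metis abs_ge_self abs_mult)
  also have "\<dots> \<le> (\<Sum>n\<in>s. \<bar>a n\<bar> * (\<Sum>j=1..J. if (1/2) ^ j \<le> w n then 2 * (1/2) ^ j else 0))"
    by (intro sum_mono mult_left_mono dyadic_bound w J) auto
  also have "\<dots> = (\<Sum>j=1..J. \<Sum>n\<in>s. if (1/2) ^ j \<le> w n then 2 * (1/2) ^ j * \<bar>a n\<bar> else 0)"
    unfolding sum_distrib_left by (subst sum.swap) (intro sum.cong, auto)
  also have "\<dots> = (\<Sum>j=1..J. 2 * (1/2) ^ j * (\<Sum>n\<in>{n\<in>s. (1/2) ^ j \<le> w n}. \<bar>a n\<bar>))"
    using fin by (intro sum.cong refl) (auto simp: sum.inter_filter sum_distrib_left intro!: sum.cong)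
  also have "\<dots> \<le> (\<Sum>j=1..J. 2 * (1/2) ^ j * (real j * M))"
    by (intro sum_mono mult_left_mono level_sum) auto
  also have "\<dots> = 2 * M * (\<Sum>j=1..J. real j * (1/2) ^ j)"
    by (simp add: sum_distrib_left algebra_simps)
  also have "\<dots> \<le> 2 * M * 2"
    using M by (intro mult_left_mono sum_weights_le) simp
  finally show ?thesis by simp
qed

text \<open>
  The coefficients are transported along \<open>\<iota>\<close> to a sequence \<open>b\<close>, to which the formula for the
  Schreier norm applies.
\<close>

lemma sum_le_norm_schreier:
  assumes "schreier_space \<phi> \<alpha> V e" "fundamental_sequences \<phi>" "\<alpha> < omega1" "a \<in> c00"
    and \<iota>: "strict_mono_on {1..} \<iota>" "1 \<le> \<iota> 1"
    and A: "A \<subseteq> {1..}" "\<iota> ` A \<in> schreier_family \<phi> \<alpha>"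
  shows "(\<Sum>n\<in>A. \<bar>a n\<bar>) \<le> norm (lin_comb a (\<lambda>n. e (\<iota> n)))"
proof -
  have inj: "inj_on \<iota> {1..}" using \<iota>(1) by (rule strict_mono_on_imp_inj_on)
  have pos: "1 \<le> \<iota> n" if "1 \<le> n" for n
    using \<iota>(2) strict_mono_onD[OF \<iota>(1), of 1 n] that by (cases "n = 1") auto
  define b where "b m = (if m \<in> \<iota> ` {1..} then a (inv_into {1..} \<iota> m) else 0)" for m
  have b: "b (\<iota> n) = a n" if "1 \<le> n" for n
    using that inj by (simp add: b_def)
  have s: "{n. a n \<noteq> 0} \<subseteq> {1..}" and fin: "finite {n. a n \<noteq> 0}"
    by (rule c00_support[OF assms(4)])+
  have supp: "{m. b m \<noteq> 0} = \<iota> ` {n. a n \<noteq> 0}"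
  proof (intro equalityI subsetI)
    fix m assume "m \<in> {m. b m \<noteq> 0}"
    then have "b m \<noteq> 0" by simp
    then obtain n where "1 \<le> n" "m = \<iota> n" by (auto simp: b_def split: if_splits)
    then show "m \<in> \<iota> ` {n. a n \<noteq> 0}" using \<open>b m \<noteq> 0\<close> b by auto
  qed (use s b in \<open>auto simp: subset_iff\<close>)
  have "b \<in> c00"
  proof -
    have "b 0 = 0" using pos unfolding b_def by force
    then show ?thesis using supp fin by (simp add: c00_def)
  qed
  have "lin_comb b e = (\<Sum>n | a n \<noteq> 0. b (\<iota> n) *\<^sub>R e (\<iota> n))"
    unfolding lin_comb_def supp sum.reindex[OF inj_on_subset[OF inj s]] by simp
  also have "\<dots> = lin_comb a (\<lambda>n. e (\<iota> n))"
    unfolding lin_comb_def using s b by (intro sum.cong) (auto simp: subset_iff)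
  finally have "schreier_norm \<phi> \<alpha> b = norm (lin_comb a (\<lambda>n. e (\<iota> n)))"
    using assms(1) \<open>b \<in> c00\<close> unfolding schreier_space_def by metis
  moreover have "(\<Sum>m\<in>\<iota> ` A. \<bar>b m\<bar>) \<le> schreier_norm \<phi> \<alpha> b"
    unfolding schreier_norm_def using A(2) \<open>b \<in> c00\<close>
    by (intro Max_ge finite_schreier_sums[OF assms(2,3)]) (auto simp: c00_def)
  moreover have "(\<Sum>m\<in>\<iota> ` A. \<bar>b m\<bar>) = (\<Sum>n\<in>A. \<bar>a n\<bar>)"
    unfolding sum.reindex[OF inj_on_subset[OF inj A(1)]]
    using A(1) b by (intro sum.cong) (auto simp: subset_iff)
  ultimately show ?thesis by simp
qed

section \<open>Szlenk index and upper tree estimates\<close>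

theorem theorem1p1:
  fixes \<alpha> :: ordinal
    and \<phi> :: "ordinal \<Rightarrow> nat \<Rightarrow> ordinal"
    and V :: "'v::banach set"
    and e :: "nat \<Rightarrow> 'v"
  assumes "separable_space (euclidean :: 'a::banach topology)"
    and "infinite_dimensional TYPE('a)"
    and "\<alpha> < omega1"
    and "szlenk_index TYPE('a) \<le> ord_pow omega0 \<alpha>"
    and "fundamental_sequences \<phi>"
    and "schreier_space \<phi> \<alpha> V e"
  shows "upper_tree_estimates TYPE('a) e"
proof -
  let ?S = "schreier_family \<phi> \<alpha>"
  have "upper_tree_estimates_const TYPE('a) 4 e"
    unfolding upper_tree_estimates_const_def
  proof (intro allI impI)
    fix x :: "nat list \<Rightarrow> 'a"
    assume x: "normalized_tree x \<and> weakly_null_tree x"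
    have "controlled \<epsilon> (UNIV :: ('a \<Rightarrow>\<^sub>L real) set) ?S" if "\<epsilon> > 0" for \<epsilon>
      using schreier_family_accommodates[OF assms(5,3)]
      by (rule controlled_UNIV[OF assms(4,3) that])
    then obtain \<kappa> where \<kappa>: "\<And>n. branch_controlled ?S x n \<kappa>"
      using controlled_branch[of x ?S] x by blast
    have T: "map \<kappa> [1..<2 * n + 1] \<in> T_fin (2 * n)" for n
      using \<kappa>[of n] unfolding branch_controlled_def by blast
    have mono: "strict_mono_on {1..} \<kappa>"
    proof (rule strict_mono_onI)
      fix i i' :: nat assume i: "i \<in> {1..}" "i < i'"
      have "sorted_wrt (<) (map \<kappa> [1..<2 * i' + 1])"
        using T[of i'] by (simp add: T_fin_def)
      from sorted_wrt_nth_less[OF this, of "i - 1" "i' - 1"] show "\<kappa> i < \<kappa> i'"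
        using i by (simp del: upt_Suc)
    qed
    have "\<kappa> 1 \<in> set (map \<kappa> [1..<2 * 1 + 1])" by simp
    then have one: "1 \<le> \<kappa> 1"
      using T[of 1] unfolding T_fin_def by blast
    define \<iota> where "\<iota> n = \<kappa> (2 * n - 1)" for n
    have \<iota>: "strict_mono_on {1..} \<iota>" "1 \<le> \<iota> 1"
      using one by (auto simp: \<iota>_def intro!: strict_mono_onI strict_mono_onD[OF mono])
    have \<iota>_pos: "1 \<le> \<iota> n" if "1 \<le> n" for n
      using \<iota>(2) strict_mono_onD[OF \<iota>(1), of 1 n] that by (cases "n = 1") auto
    have "norm (lin_comb a (branch_vec x \<kappa>)) \<le> 4 * norm (lin_comb a (\<lambda>n. e (\<iota> n)))"
      if a: "a \<in> c00" for a
    proof (rule norm_lin_comb_le[OF a])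
      note le = sum_le_norm_schreier[OF assms(6,5,3) a \<iota>]
      show "norm (branch_vec x \<kappa> n) \<le> 1" if "1 \<le> n" for n
        using x T[of n] that unfolding normalized_tree_def branch_vec_def by simp
      show "\<bar>a n\<bar> \<le> norm (lin_comb a (\<lambda>n. e (\<iota> n)))" if "1 \<le> n" for n
      proof -
        have "{\<iota> n} \<in> ?S"
          using singletons_subset_schreier_family[OF assms(5,3)] \<iota>_pos[OF that]
          by (auto simp: singletons_def)
        then show ?thesis using le[of "{n}"] that by simp
      qed
      fix f :: "'a \<Rightarrow>\<^sub>L real" and j A
      assume *: "f \<in> dual_ball" "1 \<le> j" "finite A" "A \<subseteq> {j..}"
        "\<And>i. i \<in> A \<Longrightarrow> (1/2) ^ j \<le> \<bar>blinfun_apply f (branch_vec x \<kappa> i)\<bar>"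
      have "\<iota> ` A \<in> ?S"
        using branch_controlledD[OF \<kappa> *(2,3,4,1,5)] by (simp add: \<iota>_def)
      then show "(\<Sum>i\<in>A. \<bar>a i\<bar>) \<le> norm (lin_comb a (\<lambda>n. e (\<iota> n)))"
        using *(2,4) by (intro le) auto
    qed
    then have "dominated 4 (\<lambda>n. x (map \<kappa> [1..<2 * n + 1])) (\<lambda>n. e (\<kappa> (2 * n - 1)))"
      unfolding dominated_def branch_vec_def \<iota>_def by blast
    then show "\<exists>k. strict_mono_on {1..} k \<and> 1 \<le> k 1 \<and>
        dominated 4 (\<lambda>n. x (map k [1..<2 * n + 1])) (\<lambda>n. e (k (2 * n - 1)))"
      using mono one by blast
  qed
  then show ?thesis
    unfolding upper_tree_estimates_def by (intro exI[of _ 4]) simp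
qed

end
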